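(* Up to scaling all sizes by a positive factor, rotating, and reversing the circular order, there is a unique cutting of the pizza into $21$ slices having at most two different slice sizes for which Bob has a strategy with gain $5|P|/9$; namely the cutting with sizes, in circular order, $$0,0,1,0,1,0,0,1,0,1,0,1,0,0,1,0,1,0,1,0,1.$$
   Context: The pizza game: a pizza is cut into $n\ge1$ slices forming a circular sequence $P=p_0p_1\dots p_{n-1}$ (indices modulo $n$, $p_i$ adjacent to $p_{i\pm1}$), each slice having a size $|p_i|\ge 0$; $|P|=\sum_i|p_i|$. Alice and Bob alternately take slices, one per turn, Alice first. In the first turn Alice may take any slice; in every later turn the player must take a slice that has a neighbor already taken. A strategy has gain $g$ if it guarantees the player a set of slices of total size at least $g$, whatever the opponent does.
   Formalization: The pizza is assumed to have positive total size |P| > 0; the all-zero cutting, for which Bob trivially has gain 0 = 5|P|/9, would otherwise be a second cutting and contradict uniqueness. *)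

theory Defs
  imports Complex_Main
begin

text \<open>A cutting is the list of slice sizes in circular order; slices are identified
  with their positions in the list.\<close>

definition cutting :: "real list \<Rightarrow> bool" where
  "cutting P \<longleftrightarrow> P \<noteq> [] \<and> (\<forall>x\<in>set P. 0 \<le> x)"

definition adjacent_slices :: "nat \<Rightarrow> nat \<Rightarrow> nat \<Rightarrow> bool" where
  "adjacent_slices n i j \<longleftrightarrow> i < n \<and> j < n \<and> (j = (i + 1) mod n \<or> i = (j + 1) mod n)"

definition can_take :: "nat \<Rightarrow> nat list \<Rightarrow> nat \<Rightarrow> bool" where
  "can_take n h i \<longleftrightarrow>
     i < n \<and> i \<notin> set h \<and> (h = [] \<or> (\<exists>j\<in>set h. adjacent_slices n i j))"

text \<open>A (possibly unfinished) play is the list of slices taken so far, earliest first.\<close>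

inductive play :: "nat \<Rightarrow> nat list \<Rightarrow> bool" for n where
  start: "play n []"
| move: "play n h \<Longrightarrow> can_take n h i \<Longrightarrow> play n (h @ [i])"

datatype player = Alice | Bob

text \<open>Turns are counted from 0.\<close>

definition mover :: "nat \<Rightarrow> player" where
  "mover k = (if even k then Alice else Bob)"

text \<open>A strategy maps the history of the game to the next slice to take. It is constrained
  only at unfinished plays where it is the player's turn.\<close>

type_synonym strategy = "nat list \<Rightarrow> nat"

definition strategy_for :: "nat \<Rightarrow> player \<Rightarrow> strategy \<Rightarrow> bool" where
  "strategy_for n X \<sigma> \<longleftrightarrow>
     (\<forall>h. play n h \<and> length h < n \<and> mover (length h) = X \<longrightarrow> can_take n h (\<sigma> h))"

definition follows :: "player \<Rightarrow> strategy \<Rightarrow> nat list \<Rightarrow> bool" where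
  "follows X \<sigma> h \<longleftrightarrow> (\<forall>k<length h. mover k = X \<longrightarrow> h ! k = \<sigma> (take k h))"

definition total_taken :: "real list \<Rightarrow> player \<Rightarrow> nat list \<Rightarrow> real" where
  "total_taken P X h = (\<Sum>k | k < length h \<and> mover k = X. P ! (h ! k))"

definition has_gain :: "real list \<Rightarrow> player \<Rightarrow> strategy \<Rightarrow> real \<Rightarrow> bool" where
  "has_gain P X \<sigma> g \<longleftrightarrow>
     strategy_for (length P) X \<sigma> \<and>
     (\<forall>h. play (length P) h \<and> length h = length P \<and> follows X \<sigma> h \<longrightarrow> g \<le> total_taken P X h)"

definition same_cutting :: "real list \<Rightarrow> real list \<Rightarrow> bool" where
  "same_cutting P Q \<longleftrightarrow>
     (\<exists>c>0. \<exists>k. P = map ((*) c) (rotate k Q) \<or> P = map ((*) c) (rotate k (rev Q)))"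

end

theory Submission
  imports Defs
begin

text \<open>
  After Alice's first move the pizza is a path, from which both players take end slices, so Bob's gain
  is decided by backward induction on paths. Alice takes 11 of the 21 slices; hence for two sizes
  \<open>x \<le> y\<close> the problem reduces to the 0/1 pattern of the larger size, a positive \<open>x\<close> being in
  Alice's favour.

  By always answering on the side where Bob has just moved, Alice starting at a slice gets a set that
  is a half circle, containing this slice, of the circle of the slices 0, 2, 4, ... If Bob has gain
  5/9 and there are \<open>k\<close> ones, every slice therefore lies in a half circle with at most
  \<open>t = 4k div 9\<close> ones. As not all half circles are that light, some rotation makes the one of slice 0
  light and the one of slice 19 heavy. This fixes the number of ones at even positions to \<open>t\<close>, and
  the light half circles that cover the odd positions constrain the prefix sums so much that about
  15000 patterns remain, which are settled by evaluating the game.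
\<close>

section \<open>Backward induction\<close>

text \<open>Alice's further income under optimal play with \<open>k\<close> turns left. Only her
  slices are counted, since the two final totals add up to the whole pizza.\<close>

primrec history_value :: "real list \<Rightarrow> nat \<Rightarrow> nat list \<Rightarrow> real" where
  "history_value P 0 h = 0"
| "history_value P (Suc k) h =
    (if mover (length h) = Alice
     then Max ((\<lambda>i. P ! i + history_value P k (h @ [i])) ` {i. can_take (length P) h i})
     else Min ((\<lambda>i. history_value P k (h @ [i])) ` {i. can_take (length P) h i}))"

lemma finite_can_take [simp]: "finite {i. can_take n h i}"
  by (rule finite_subset[of _ "{..<n}"]) (auto simp: can_take_def)

lemma play_bounds: "play n h \<Longrightarrow> distinct h \<and> set h \<subseteq> {..<n}"
  by (induction rule: play.induct) (auto simp: can_take_def)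

lemma play_length_le: "play n h \<Longrightarrow> length h \<le> n"
  using play_bounds[of n h] distinct_card[of h] card_mono[of "{..<n}" "set h"] by auto

section \<open>Taken slices as arcs of the circle\<close>

lemma mod_add_cancel_less:
  fixes n s a b :: nat
  assumes "(s + a) mod n = (s + b) mod n" "a < n" "b < n"
  shows "a = b"
proof -
  have *: "b = a" if "(s + a) mod n = (s + b) mod n" "a < n" "b < n" "a \<le> b" for a b
  proof -
    have "n dvd (s + b) - (s + a)"
      using that(1,4) mod_eq_dvd_iff_nat[of "s + a" "s + b" n] by simp
    then have "n dvd b - a" by simp
    then have "b - a = 0" using that(3) by (meson dvd_imp_le less_imp_diff_less linorder_not_le neq0_conv)
    then show ?thesis using that(4) by simp
  qed
  show ?thesis by (metis * assms nat_le_linear)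
qed

lemma mod_shift_ex:
  fixes n s i :: nat
  assumes "i < n"
  obtains j where "j < n" "i = (s + j) mod n"
proof
  have n: "n > 0" using assms by simp
  show "(i + (n - s mod n)) mod n < n" using n by simp
  have "(s + (i + (n - s mod n)) mod n) mod n = (s mod n + (i + (n - s mod n))) mod n"
    by (metis mod_add_left_eq mod_add_right_eq)
  also have "s mod n + (i + (n - s mod n)) = i + n"
    using mod_less_divisor[OF n, of s] by linarith
  finally show "i = (s + (i + (n - s mod n)) mod n) mod n" using assms by simp
qed

text \<open>If the taken slices are \<open>s\<close>, ..., \<open>s + m - 1\<close> modulo the
  length, this is the untaken path, read from the slice just after the arc, so that its two ends are
  the available slices.\<close>

definition arc_rest :: "real list \<Rightarrow> nat \<Rightarrow> nat \<Rightarrow> real list" where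
  "arc_rest P s m = map (\<lambda>j. P ! ((s + j) mod length P)) [m..<length P]"

definition taken_arc :: "nat \<Rightarrow> nat list \<Rightarrow> nat \<Rightarrow> bool" where
  "taken_arc n h s \<longleftrightarrow> set h = (\<lambda>j. (s + j) mod n) ` {..<length h}"

text \<open>In the coordinate \<open>j\<close> measured from \<open>s\<close> the taken slices are
  \<open>j < length h\<close>, so the free neighbours are \<open>j = length h\<close> and
  \<open>j = n - 1\<close>, which coincide before the last move. Adding \<open>n - 1\<close> steps
  back by one without natural subtraction.\<close>

lemma can_take_arc:
  assumes h: "taken_arc n h s" and len: "0 < length h" "length h < n"
  shows "can_take n h i \<longleftrightarrow> i = (s + length h) mod n \<or> i = (s + (n - 1)) mod n"
proof -
  let ?m = "length h"
  have n: "n > 1" using len by linarith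
  have mem: "(s + j) mod n \<in> set h \<longleftrightarrow> j < ?m" if "j < n" for j
    using h mod_add_cancel_less[of s j n] that len unfolding taken_arc_def by fastforce
  have adj: "adjacent_slices n ((s + j) mod n) ((s + j') mod n) \<longleftrightarrow>
      j' = (j + 1) mod n \<or> j = (j' + 1) mod n" if "j < n" "j' < n" for j j'
  proof -
    have "((s + j') mod n = ((s + j) mod n + 1) mod n) = (j' = (j + 1) mod n)" if "j' < n" for j j'
    proof -
      have "((s + j) mod n + 1) mod n = (s + (j + 1) mod n) mod n"
        by (metis add.assoc mod_add_left_eq mod_add_right_eq)
      then show ?thesis using mod_add_cancel_less[of s j' n "(j + 1) mod n"] that by auto
    qed
    from this[of j' j] this[of j j'] show ?thesis
      using that n unfolding adjacent_slices_def by simp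
  qed
  have step: "can_take n h ((s + j) mod n) \<longleftrightarrow> j = ?m \<or> j = n - 1" if j: "j < n" for j
  proof
    assume "can_take n h ((s + j) mod n)"
    then obtain j' where *: "\<not> j < ?m" "j' < ?m" "adjacent_slices n ((s + j) mod n) ((s + j') mod n)"
      using h mem[OF j] len unfolding can_take_def taken_arc_def by auto
    then have "j = (j' + 1) mod n \<or> j' = (j + 1) mod n"
      using adj[of j j'] j len by auto
    moreover have "(j' + 1) mod n = j' + 1" using * len by simp
    moreover have "(j + 1) mod n = (if j = n - 1 then 0 else j + 1)" using j by auto
    ultimately show "j = ?m \<or> j = n - 1" using * by (auto split: if_splits)
  next
    assume a: "j = ?m \<or> j = n - 1"
    then have nm: "(s + j) mod n \<notin> set h" using mem[OF j] len by auto
    have "\<exists>j'<?m. j = (j' + 1) mod n \<or> j' = (j + 1) mod n"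
    proof (cases "j = ?m")
      case True
      then show ?thesis using len by (intro exI[of _ "?m - 1"]) auto
    next
      case False
      then show ?thesis using a len by (intro exI[of _ 0]) auto
    qed
    then obtain j' where j': "j' < ?m" "j = (j' + 1) mod n \<or> j' = (j + 1) mod n" by blast
    then have "adjacent_slices n ((s + j) mod n) ((s + j') mod n)" "(s + j') mod n \<in> set h"
      using adj[OF j, of j'] mem[of j'] len by auto
    then show "can_take n h ((s + j) mod n)"
      unfolding can_take_def using nm n by auto
  qed
  show ?thesis
  proof (cases "i < n")
    case True
    then obtain j where j: "j < n" "i = (s + j) mod n" by (rule mod_shift_ex)
    have "(s + j) mod n = (s + j') mod n \<longleftrightarrow> j = j'" if "j' < n" for j'
      using mod_add_cancel_less[OF _ j(1) that] by blast
    from this[of ?m] this[of "n - 1"] show ?thesis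
      unfolding j(2) step[OF j(1)] using len by simp
  next
    case False
    then show ?thesis using n by (auto simp: can_take_def)
  qed
qed

lemma taken_arc_right:
  "taken_arc n h s \<Longrightarrow> taken_arc n (h @ [(s + length h) mod n]) s"
  unfolding taken_arc_def by (auto simp: lessThan_Suc)

lemma taken_arc_left:
  assumes "taken_arc n h s" "0 < n"
  shows "taken_arc n (h @ [(s + (n - 1)) mod n]) (s + (n - 1))"
proof -
  have "(s + (n - 1) + Suc j) mod n = (s + j) mod n" for j
  proof -
    have "s + (n - 1) + Suc j = (s + j) + n" using assms(2) by simp
    then show ?thesis by (metis mod_add_self2)
  qed
  then have "(\<lambda>j. (s + (n - 1) + j) mod n) ` Suc ` {..<length h} = set h"
    using assms(1) unfolding taken_arc_def image_image by simp
  then show ?thesis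
    unfolding taken_arc_def by (simp add: lessThan_Suc_eq_insert_0)
qed

lemma arc_rest_left:
  assumes "m < length P"
  shows "arc_rest P (s + (length P - 1)) (Suc m) = butlast (arc_rest P s m)"
    and "P ! ((s + (length P - 1)) mod length P) = last (arc_rest P s m)"
proof -
  let ?n = "length P"
  obtain k where k: "?n = Suc k" using assms by (cases ?n) auto
  have "(s + (?n - 1) + Suc j) mod ?n = (s + j) mod ?n" for j
  proof -
    have "s + (?n - 1) + Suc j = (s + j) + ?n" using assms by simp
    then show ?thesis by (metis mod_add_self2)
  qed
  then have "arc_rest P (s + (?n - 1)) (Suc m) = map (\<lambda>j. P ! ((s + j) mod ?n)) [m..<k]"
    unfolding arc_rest_def k map_Suc_upt[symmetric] map_map by (auto simp: k)
  then show "arc_rest P (s + (?n - 1)) (Suc m) = butlast (arc_rest P s m)"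
    unfolding arc_rest_def using k assms by (simp add: butlast_append)
  show "P ! ((s + (?n - 1)) mod ?n) = last (arc_rest P s m)"
    unfolding arc_rest_def using k assms by (simp add: last_map)
qed

lemma arc_rest_right:
  assumes "m < length P"
  shows "arc_rest P s (Suc m) = tl (arc_rest P s m)"
    and "P ! ((s + m) mod length P) = hd (arc_rest P s m)"
  using assms by (simp_all add: arc_rest_def upt_conv_Cons)

lemma play_arc: "play n h \<Longrightarrow> h \<noteq> [] \<Longrightarrow> \<exists>s. taken_arc n h s"
proof (induction rule: play.induct)
  case (move h i)
  show ?case
  proof (cases "h = []")
    case True
    then show ?thesis using move by (intro exI[of _ i]) (auto simp: taken_arc_def can_take_def lessThan_Suc)
  next
    case False
    then obtain s where s: "taken_arc n h s" using move by auto
    have "length h < n" using play_length_le[OF play.move[OF move(1,2)]] by simp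
    then have "i = (s + length h) mod n \<or> i = (s + (n - 1)) mod n"
      using can_take_arc[OF s, of i] move False by auto
    then show ?thesis using taken_arc_right[OF s] taken_arc_left[OF s] \<open>length h < n\<close> by fastforce
  qed
qed simp

lemma can_take_ex:
  assumes "play n h" "length h < n"
  shows "\<exists>i. can_take n h i"
proof (cases "h = []")
  case True
  then show ?thesis using assms by (auto simp: can_take_def)
next
  case False
  then obtain s where "taken_arc n h s" using play_arc assms by blast
  then show ?thesis using can_take_arc[of n h s] False assms by auto
qed

section \<open>Bob's gain as the value of the game\<close>

lemma total_taken_snoc:
  "total_taken P X (h @ [i]) = total_taken P X h + (if mover (length h) = X then P ! i else 0)"
proof -
  have *: "total_taken P X h = (\<Sum>k<length h. if mover k = X then P ! (h ! k) else 0)" for h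
  proof -
    have "{k. k < length h \<and> mover k = X} = {k \<in> {..<length h}. mover k = X}" by auto
    then show ?thesis by (simp only: total_taken_def sum.inter_filter finite_lessThan)
  qed
  have "(\<Sum>k<length h. if mover k = X then P ! ((h @ [i]) ! k) else 0) =
      (\<Sum>k<length h. if mover k = X then P ! (h ! k) else 0)"
    by (rule sum.cong) (auto simp: nth_append)
  then show ?thesis unfolding * by simp
qed

lemma total_taken_full:
  assumes "play (length P) h" "length h = length P"
  shows "total_taken P Alice h + total_taken P Bob h = sum_list P"
proof -
  have "total_taken P Alice h' + total_taken P Bob h' = (\<Sum>i\<leftarrow>h'. P ! i)" for h'
  proof (induction h' rule: rev_induct)
    case Nil
    show ?case by (simp add: total_taken_def)
  next
    case (snoc i h')
    then show ?case by (auto simp: total_taken_snoc mover_def)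
  qed
  moreover have "(\<Sum>i\<leftarrow>h. P ! i) = (\<Sum>i\<in>set h. P ! i)"
    using play_bounds[OF assms(1)] by (intro sum_list_distinct_conv_sum_set) simp
  moreover have "set h = {..<length P}"
    using play_bounds[OF assms(1)] assms(2)
    by (metis card_lessThan card_subset_eq distinct_card finite_lessThan)
  ultimately show ?thesis by (simp only: sum_list_sum_nth[of P] atLeast0LessThan)
qed

lemma follows_snoc:
  "follows X \<sigma> (h @ [i]) \<longleftrightarrow> follows X \<sigma> h \<and> (mover (length h) = X \<longrightarrow> i = \<sigma> h)"
  unfolding follows_def by (auto simp: nth_append less_Suc_eq)

text \<open>Alice picks a maximizing slice at each of her turns, and whatever \<sigma> picks at
  Bob's turns is at least the minimum, so the value bounds her final total from below.\<close>

lemma play_against_strategy: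
  assumes "strategy_for (length P) Bob \<sigma>"
  shows "play (length P) h \<Longrightarrow> follows Bob \<sigma> h \<Longrightarrow> length h + k = length P \<Longrightarrow>
    \<exists>h'. play (length P) h' \<and> follows Bob \<sigma> h' \<and> length h' = length P \<and>
      total_taken P Alice h + history_value P k h \<le> total_taken P Alice h'"
proof (induction k arbitrary: h)
  case 0
  then show ?case by auto
next
  case (Suc k)
  let ?M = "{i. can_take (length P) h i}"
  have ne: "?M \<noteq> {}" using can_take_ex[OF Suc.prems(1)] Suc.prems(3) by auto
  obtain i where i: "can_take (length P) h i" "mover (length h) = Bob \<Longrightarrow> i = \<sigma> h"
     "total_taken P Alice h + history_value P (Suc k) h \<le> total_taken P Alice (h @ [i]) + history_value P k (h @ [i])"
  proof (cases "mover (length h) = Alice")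
    case True
    have "history_value P (Suc k) h \<in> (\<lambda>i. P ! i + history_value P k (h @ [i])) ` ?M"
      using True ne by simp
    then show ?thesis using that True by (force simp: total_taken_snoc)
  next
    case False
    then have B: "mover (length h) = Bob" by (cases "mover (length h)") auto
    have c: "can_take (length P) h (\<sigma> h)"
      using assms Suc.prems B unfolding strategy_for_def by simp
    then have "history_value P (Suc k) h \<le> history_value P k (h @ [\<sigma> h])"
      using B by (auto intro!: Min_le)
    then show ?thesis using that[of "\<sigma> h"] c B by (auto simp: total_taken_snoc)
  qed
  have "play (length P) (h @ [i])" using Suc.prems i by (auto intro: play.move)
  then show ?case using Suc.IH[of "h @ [i]"] Suc.prems i by (fastforce simp: follows_snoc)
qed

text \<open>The game has constant sum \<open>sum_list P\<close>. If the value is too large, Alice's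
  counterplay defeats every \<sigma>; otherwise Bob wins by minimizing the value.\<close>

lemma Bob_gain_iff_history_value:
  "(\<exists>\<sigma>. has_gain P Bob \<sigma> g) \<longleftrightarrow> history_value P (length P) [] \<le> sum_list P - g"
proof
  assume "\<exists>\<sigma>. has_gain P Bob \<sigma> g"
  then obtain \<sigma> where s: "strategy_for (length P) Bob \<sigma>"
    "\<And>h. play (length P) h \<Longrightarrow> length h = length P \<Longrightarrow> follows Bob \<sigma> h \<Longrightarrow> g \<le> total_taken P Bob h"
    unfolding has_gain_def by auto
  have "follows Bob \<sigma> []" by (simp add: follows_def)
  then obtain h where h: "play (length P) h" "follows Bob \<sigma> h" "length h = length P"
    "total_taken P Alice [] + history_value P (length P) [] \<le> total_taken P Alice h"
    using play_against_strategy[OF s(1) play.start, of "length P"] by auto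
  then show "history_value P (length P) [] \<le> sum_list P - g"
    using s(2)[OF h(1,3,2)] total_taken_full[OF h(1,3)] by (simp add: total_taken_def)
next
  assume v: "history_value P (length P) [] \<le> sum_list P - g"
  let ?V = "\<lambda>h i. history_value P (length P - Suc (length h)) (h @ [i])"
  define \<sigma> where "\<sigma> h = (ARG_MIN (?V h) i. can_take (length P) h i)" for h
  have \<sigma>: "can_take (length P) h (\<sigma> h) \<and> ?V h (\<sigma> h) = Min (?V h ` {i. can_take (length P) h i})"
    if h: "play (length P) h" "length h < length P" for h
  proof -
    let ?M = "{i. can_take (length P) h i}"
    have ne: "?M \<noteq> {}" using can_take_ex h by auto
    have "\<sigma> h = arg_min_on (?V h) ?M" by (simp add: \<sigma>_def arg_min_on_def)
    then have *: "\<sigma> h \<in> ?M" "\<And>i. i \<in> ?M \<Longrightarrow> ?V h (\<sigma> h) \<le> ?V h i"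
      using arg_min_if_finite[OF finite_can_take ne, of "?V h"] by (auto simp: not_less)
    then show ?thesis by (auto intro!: Min_eqI[symmetric])
  qed
  \<comment> \<open>Alice's total plus her remaining value does not rise at her moves, which the
    maximum bounds, and stays constant at Bob's minimizing ones.\<close>
  have inv: "follows Bob \<sigma> h \<Longrightarrow>
      total_taken P Alice h + history_value P (length P - length h) h \<le> sum_list P - g"
    if "play (length P) h" for h
    using that
  proof (induction rule: play.induct)
    case start
    then show ?case using v by (simp add: total_taken_def)
  next
    case (move h i)
    have l: "length h < length P" using play_length_le[OF play.move[OF move(1,2)]] by simp
    then obtain k where k: "length P - length h = Suc k" "length P - Suc (length h) = k"
      by (metis Suc_diff_Suc)
    have f: "follows Bob \<sigma> h" "mover (length h) = Bob \<Longrightarrow> i = \<sigma> h"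
      using move.prems by (auto simp: follows_snoc)
    show ?case
    proof (cases "mover (length h) = Alice")
      case True
      then have "P ! i + history_value P k (h @ [i]) \<le> history_value P (Suc k) h"
        using move(2) by (auto intro!: Max_ge)
      then show ?thesis using move.IH[OF f(1)] True k by (simp add: total_taken_snoc)
    next
      case False
      then have B: "mover (length h) = Bob" by (cases "mover (length h)") auto
      then show ?thesis
        using move.IH[OF f(1)] \<sigma>[OF move(1) l] k f(2) by (simp add: total_taken_snoc)
    qed
  qed
  have "g \<le> total_taken P Bob h"
    if "play (length P) h" "length h = length P" "follows Bob \<sigma> h" for h
    using inv[OF that(1,3)] total_taken_full[OF that(1,2)] that(2) by simp
  moreover have "strategy_for (length P) Bob \<sigma>"
    unfolding strategy_for_def using \<sigma> by blast
  ultimately show "\<exists>\<sigma>. has_gain P Bob \<sigma> g" unfolding has_gain_def by blast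
qed

section \<open>The game on a path\<close>

fun path_value :: "player \<Rightarrow> real list \<Rightarrow> real" where
  "path_value X [] = 0"
| "path_value Alice (x # xs) =
    max (x + path_value Bob xs) (last (x # xs) + path_value Bob (butlast (x # xs)))"
| "path_value Bob (x # xs) = min (path_value Alice xs) (path_value Alice (butlast (x # xs)))"

lemma history_value_arc:
  "taken_arc (length P) h s \<Longrightarrow> h \<noteq> [] \<Longrightarrow> length h + k = length P \<Longrightarrow>
    history_value P k h = path_value (mover (length h)) (arc_rest P s (length h))"
proof (induction k arbitrary: h s)
  case 0
  then show ?case by (simp add: arc_rest_def)
next
  case (Suc k)
  let ?n = "length P" and ?xs = "arc_rest P s (length h)"
  let ?i = "(s + length h) mod length P" and ?j = "(s + (length P - 1)) mod length P"
  have l: "0 < length h" "length h < length P" using Suc.prems by auto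
  have l': "0 < ?n" "length (h @ [a]) + k = length P" for a using Suc.prems by auto
  have M: "{i. can_take (length P) h i} = {?i, ?j}"
    using can_take_arc[OF Suc.prems(1) l] by auto
  have v: "history_value P k (h @ [?i]) = path_value (mover (Suc (length h))) (tl ?xs)"
     "history_value P k (h @ [?j]) = path_value (mover (Suc (length h))) (butlast ?xs)"
    unfolding arc_rest_right(1)[OF l(2), symmetric] arc_rest_left(1)[OF l(2), symmetric]
    using Suc.IH[OF taken_arc_right[OF Suc.prems(1)]]
      Suc.IH[OF taken_arc_left[OF Suc.prems(1) l'(1)]] l'(2) by simp_all
  have e: "P ! ?i = hd ?xs" "P ! ?j = last ?xs"
    using arc_rest_right(2)[OF l(2)] arc_rest_left(2)[OF l(2)] by auto
  obtain x ys where xs: "?xs = x # ys"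
    using l unfolding arc_rest_def by (simp add: upt_conv_Cons)
  show ?case
  proof (cases "mover (length h)")
    case Alice
    then have m: "mover (Suc (length h)) = Bob" by (simp add: mover_def split: if_splits)
    have "history_value P (Suc k) h =
        max (P ! ?i + history_value P k (h @ [?i])) (P ! ?j + history_value P k (h @ [?j]))"
      by (simp only: history_value.simps M Alice if_True image_insert image_empty) simp
    also have "\<dots> = path_value Alice ?xs"
      unfolding v e m xs by (simp only: path_value.simps list.sel)
    finally show ?thesis unfolding Alice .
  next
    case Bob
    then have m: "mover (Suc (length h)) = Alice" by (simp add: mover_def split: if_splits)
    have "history_value P (Suc k) h =
        min (history_value P k (h @ [?i])) (history_value P k (h @ [?j]))"
      by (simp only: history_value.simps M Bob player.distinct if_False image_insert image_empty) simp
    also have "\<dots> = path_value Bob ?xs"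
      unfolding v e m xs by (simp only: path_value.simps list.sel)
    finally show ?thesis unfolding Bob .
  qed
qed

text \<open>The first slice \<open>r\<close> leaves a path with Bob to move. Alice is free to choose
  \<open>r\<close>, so Bob has to cope with every one of them.\<close>

theorem Bob_gain_iff:
  assumes "P \<noteq> []"
  shows "(\<exists>\<sigma>. has_gain P Bob \<sigma> g) \<longleftrightarrow>
    (\<forall>r<length P. P ! r + path_value Bob (arc_rest P r 1) \<le> sum_list P - g)"
proof -
  obtain k where k: "length P = Suc k" using assms by (cases "length P") auto
  have M: "{i. can_take (length P) [] i} = {..<length P}" by (auto simp: can_take_def)
  have "history_value P k [r] = path_value Bob (arc_rest P r 1)" if "r < length P" for r
    using history_value_arc[of P "[r]" r k] that k by (simp add: taken_arc_def lessThan_Suc mover_def)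
  then have "(\<lambda>i. P ! i + history_value P k ([] @ [i])) ` {i. can_take (length P) [] i}
      = (\<lambda>r. P ! r + path_value Bob (arc_rest P r 1)) ` {..<length P}"
    unfolding M by (intro image_cong) auto
  then have "history_value P (length P) [] = Max ((\<lambda>r. P ! r + path_value Bob (arc_rest P r 1)) ` {..<length P})"
    by (simp add: k mover_def)
  moreover have "{..<length P} \<noteq> {}" using k by auto
  ultimately show ?thesis by (auto simp add: Bob_gain_iff_history_value)
qed

fun path_count :: "player \<Rightarrow> bool list \<Rightarrow> nat" where
  "path_count X [] = 0"
| "path_count Alice (x # xs) =
    max (of_bool x + path_count Bob xs) (of_bool (last (x # xs)) + path_count Bob (butlast (x # xs)))"
| "path_count Bob (x # xs) = min (path_count Alice xs) (path_count Alice (butlast (x # xs)))"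

declare path_count.simps(2,3) [simp del]

text \<open>How many slices Alice takes from a path depends only on its length and on who moves
  (half, rounded up if she does), so \<open>x\<close> contributes a constant, and scaling by
  \<open>c \<ge> 0\<close> commutes with \<open>max\<close> and \<open>min\<close>.\<close>

lemma path_value_affine:
  fixes x c :: real
  assumes "c \<ge> 0"
  shows "path_value X (map (\<lambda>b. x + c * of_bool b) w) =
    x * real ((length w + of_bool (X = Alice)) div 2) + c * real (path_count X w)"
proof (induction X w rule: path_count.induct)
  case (2 y ys)
  have b: "path_value Bob (butlast (map (\<lambda>b. x + c * of_bool b) (y # ys)))
      = x * real (length ys div 2) + c * real (path_count Bob (butlast (y # ys)))"
    unfolding map_butlast[symmetric] 2(2) by (simp only: length_butlast list.size) simp
  have l: "last (map (\<lambda>b. x + c * of_bool b) (y # ys)) = x + c * of_bool (last (y # ys))"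
    by (simp only: last_map list.distinct not_False_eq_True)
  have "path_value Alice (map (\<lambda>b. x + c * of_bool b) (y # ys)) =
     max (x + c * of_bool y + (x * real (length ys div 2) + c * real (path_count Bob ys)))
       (x + c * of_bool (last (y # ys)) + (x * real (length ys div 2) + c * real (path_count Bob (butlast (y # ys)))))"
    unfolding list.map path_value.simps b[unfolded list.map] l[unfolded list.map] 2(1) by (simp only: player.distinct of_bool_eq add_0_right)
  also have "\<dots> = max (x * real (Suc (length ys div 2)) + c * real (of_bool y + path_count Bob ys))
       (x * real (Suc (length ys div 2)) + c * real (of_bool (last (y # ys)) + path_count Bob (butlast (y # ys))))"
    by (intro arg_cong2[of _ _ _ _ max]) (simp_all add: algebra_simps)
  also have "\<dots> = x * real (Suc (length ys div 2)) + c * real (path_count Alice (y # ys))"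
    using assms by (simp only: path_count.simps of_nat_max max_mult_distrib_left if_True max_add_distrib_right)
  finally show ?case by (simp only: list.size of_bool_eq add_Suc_right add_0_right div2_Suc_Suc One_nat_def simp_thms)
next
  case (3 y ys)
  have b: "path_value Alice (butlast (map (\<lambda>b. x + c * of_bool b) (y # ys)))
      = x * real (Suc (length ys) div 2) + c * real (path_count Alice (butlast (y # ys)))"
    unfolding map_butlast[symmetric] 3(2) by (simp only: length_butlast list.size) simp
  have "path_value Bob (map (\<lambda>b. x + c * of_bool b) (y # ys)) =
     min (x * real (Suc (length ys) div 2) + c * real (path_count Alice ys))
       (x * real (Suc (length ys) div 2) + c * real (path_count Alice (butlast (y # ys))))"
    unfolding list.map path_value.simps b[unfolded list.map] 3(1) by (simp only: of_bool_eq Suc_eq_plus1 simp_thms)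
  also have "\<dots> = x * real (Suc (length ys) div 2) + c * real (path_count Bob (y # ys))"
    using assms by (simp only: path_count.simps of_nat_min min_mult_distrib_left if_True min_add_distrib_right)
  finally show ?case by (simp only: list.size of_bool_eq player.distinct add_Suc_right add_0_right)
qed simp

lemma path_count_two_rounds:
  "path_count Bob (a # b # xs) =
    min (max (of_bool b + path_count Bob xs)
             (of_bool (last (b # xs)) + path_count Bob (butlast (b # xs))))
        (max (of_bool a + path_count Bob (butlast (b # xs)))
             (of_bool (last (butlast (a # b # xs))) + path_count Bob (butlast (butlast (a # b # xs)))))"
proof -
  have "butlast (a # b # xs) = a # butlast (b # xs)" by simp
  then show ?thesis by (simp only: path_count.simps)
qed

text \<open>Alice answers every move of Bob on the same side: she gets the odd positions of the part
  that Bob opens from the left and the even positions of the part he opens from the right.\<close>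

lemma path_count_follow:
  assumes "length xs = 2 * n"
  shows "\<exists>l\<le>n. (\<Sum>i<l. of_bool (xs ! (2 * i + 1))) + (\<Sum>i=l..<n. of_bool (xs ! (2 * i))) \<le> path_count Bob xs"
  using assms
proof (induction n arbitrary: xs)
  case 0
  then show ?case by simp
next
  case (Suc n)
  then obtain a b ys where xs: "xs = a # b # ys" and ys: "length ys = 2 * n"
    by (auto simp: length_Suc_conv)
  let ?zs = "butlast (butlast xs)"
  have zs: "length ?zs = 2 * n" using Suc.prems by simp
  have nth: "?zs ! i = xs ! i" if "i < 2 * n" for i
    using that Suc.prems by (simp add: nth_butlast)
  have la: "last (butlast xs) = xs ! (2 * n)"
    using last_conv_nth[of "butlast xs"] nth_butlast[of "2 * n" xs] Suc.prems
    by (metis One_nat_def Suc_1 add_diff_cancel_left' diff_Suc_1 length_0_conv length_butlast lessI mult_Suc_right nat.distinct(1) plus_1_eq_Suc add_2_eq_Suc)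
  \<comment> \<open>Bob's minimum is attained at one of his two openings, and there Alice's maximum
    is at least what her reply on the same side yields.\<close>
  consider "of_bool b + path_count Bob ys \<le> path_count Bob xs"
    | "of_bool (last (butlast xs)) + path_count Bob ?zs \<le> path_count Bob xs"
    unfolding xs path_count_two_rounds by (metis max.cobounded1 max.cobounded2 min_def)
  then show ?case
  proof cases
    case 1
    obtain l where l: "l \<le> n" "(\<Sum>i<l. of_bool (ys ! (2 * i + 1))) + (\<Sum>i=l..<n. of_bool (ys ! (2 * i)))
        \<le> path_count Bob ys" using Suc.IH[OF ys] by blast
    have "(\<Sum>i<Suc l. of_bool (xs ! (2 * i + 1))) = of_bool b + (\<Sum>i<l. of_bool (ys ! (2 * i + 1)) :: nat)"
      by (simp only: sum.lessThan_Suc_shift) (simp add: xs)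
    moreover have "(\<Sum>i=Suc l..<Suc n. of_bool (xs ! (2 * i))) = (\<Sum>i=l..<n. of_bool (ys ! (2 * i)) :: nat)"
      by (simp only: sum.shift_bounds_Suc_ivl) (simp add: xs)
    ultimately show ?thesis using l 1 by (intro exI[of _ "Suc l"]) simp
  next
    case 2
    obtain l where l: "l \<le> n" "(\<Sum>i<l. of_bool (?zs ! (2 * i + 1))) + (\<Sum>i=l..<n. of_bool (?zs ! (2 * i)))
        \<le> path_count Bob ?zs" using Suc.IH[OF zs] by blast
    have "(\<Sum>i<l. of_bool (?zs ! (2 * i + 1))) = (\<Sum>i<l. of_bool (xs ! (2 * i + 1)) :: nat)"
      using l(1) by (intro sum.cong) (auto simp: nth)
    moreover have "(\<Sum>i=l..<n. of_bool (?zs ! (2 * i))) = (\<Sum>i=l..<n. of_bool (xs ! (2 * i)) :: nat)"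
      by (intro sum.cong) (auto simp: nth)
    ultimately show ?thesis using l 2 la by (intro exI[of _ l]) simp
  qed
qed

section \<open>Computing the value of a path\<close>

text \<open>Unary arithmetic by structural recursion: the searches are evaluated by rewriting with
  \<open>code_simp\<close>, on numerals unfolded to \<open>Suc\<close> form.\<close>

fun add_bool :: "bool \<Rightarrow> nat \<Rightarrow> nat" where
  "add_bool True n = Suc n"
| "add_bool False n = n"

fun nat_max :: "nat \<Rightarrow> nat \<Rightarrow> nat" where
  "nat_max 0 b = b"
| "nat_max (Suc a) 0 = Suc a"
| "nat_max (Suc a) (Suc b) = Suc (nat_max a b)"

fun nat_min :: "nat \<Rightarrow> nat \<Rightarrow> nat" where
  "nat_min 0 b = 0"
| "nat_min (Suc a) 0 = 0"
| "nat_min (Suc a) (Suc b) = Suc (nat_min a b)"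

fun nat_le :: "nat \<Rightarrow> nat \<Rightarrow> bool" where
  "nat_le 0 b = True"
| "nat_le (Suc a) 0 = False"
| "nat_le (Suc a) (Suc b) = nat_le a b"

lemma add_bool_eq: "add_bool b n = of_bool b + n"
  by (cases b) auto

lemma nat_max_eq: "nat_max a b = max a b"
  by (induction a b rule: nat_max.induct) auto

lemma nat_min_eq: "nat_min a b = min a b"
  by (induction a b rule: nat_min.induct) auto

lemma nat_le_eq: "nat_le a b \<longleftrightarrow> a \<le> b"
  by (induction a b rule: nat_le.induct) auto

text \<open>The values of all subpaths of length \<open>l + 2\<close> from those of length \<open>l\<close>, moving a window
  along the path: \<open>a, b\<close> are its first two slices, \<open>y, z\<close> its last two, and \<open>u, v, w\<close> the values of
  the three subpaths of length \<open>l\<close> inside it.\<close>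

fun next_row :: "bool \<Rightarrow> bool list \<Rightarrow> bool \<Rightarrow> bool list \<Rightarrow> nat \<Rightarrow> nat \<Rightarrow> nat list \<Rightarrow> nat list" where
  "next_row a (b # as) y (z # zs) u v (w # ws) =
     nat_min (nat_max (add_bool b w) (add_bool z v)) (nat_max (add_bool a v) (add_bool y u))
     # next_row b as z zs v w ws"
| "next_row a [] y zs u v ws = []"
| "next_row a (b # as) y [] u v ws = []"
| "next_row a (b # as) y (z # zs) u v [] = []"

text \<open>Dynamic programming over windows of lengths 0, 2, 4, ...: \<open>a # as\<close> is
  always the whole path, the next list is the path without its first \<open>l\<close> slices, and
  the last one holds the values of all windows of length \<open>l\<close>. The path is used up when
  a single window is left.\<close>

fun rows :: "bool \<Rightarrow> bool list \<Rightarrow> bool list \<Rightarrow> nat list \<Rightarrow> nat" where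
  "rows a as (y # z # zs) (u # v # vs) = rows a as zs (next_row a as y (z # zs) u v vs)"
| "rows a as [] (u # us) = u"
| "rows a as [z] (u # us) = u"
| "rows a as zs [] = 0"
| "rows a as (y # z # zs) [u] = u"

definition path_count_rows :: "bool list \<Rightarrow> nat" where
  "path_count_rows xs =
    (case xs of [] \<Rightarrow> 0 | a # as \<Rightarrow> rows a as xs (replicate (Suc (length xs)) 0))"

definition window :: "bool list \<Rightarrow> nat \<Rightarrow> nat \<Rightarrow> nat" where
  "window xs l i = path_count Bob (take l (drop i xs))"

lemma window_step:
  assumes "i + Suc (Suc l) \<le> length xs"
  shows "window xs (Suc (Suc l)) i =
    min (max (of_bool (xs ! Suc i) + window xs l (Suc (Suc i))) (of_bool (xs ! (i + Suc l)) + window xs l (Suc i)))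
        (max (of_bool (xs ! i) + window xs l (Suc i)) (of_bool (xs ! (i + l)) + window xs l i))"
proof -
  let ?ys = "take l (drop (Suc (Suc i)) xs)"
  have d: "drop i xs = xs ! i # xs ! Suc i # drop (Suc (Suc i)) xs"
    using assms by (simp add: Cons_nth_drop_Suc)
  then have e: "take (Suc (Suc l)) (drop i xs) = xs ! i # xs ! Suc i # ?ys" by simp
  have d': "drop (Suc i) xs = xs ! Suc i # drop (Suc (Suc i)) xs"
    using assms by (simp add: Cons_nth_drop_Suc)
  then have t: "xs ! Suc i # ?ys = take (Suc l) (drop (Suc i) xs)" by simp
  have bl: "butlast (xs ! Suc i # ?ys) = take l (drop (Suc i) xs)"
    using assms unfolding t by (simp add: butlast_take)
  have la: "last (xs ! Suc i # ?ys) = xs ! (i + Suc l)"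
    using assms unfolding t by (subst last_conv_nth) (auto simp: min.absorb2)
  have bb: "butlast (take (Suc (Suc l)) (drop i xs)) = take (Suc l) (drop i xs)"
    using assms by (simp add: butlast_take)
  have lb: "last (take (Suc l) (drop i xs)) = xs ! (i + l)"
    using assms by (subst last_conv_nth) (auto simp: min.absorb2)
  have bbb: "butlast (take (Suc l) (drop i xs)) = take l (drop i xs)"
    using assms by (simp add: butlast_take)
  show ?thesis
    unfolding window_def e path_count_two_rounds bl la
    unfolding e[symmetric] bb lb bbb by (rule refl)
qed

lemma next_row_window:
  assumes "i + l < length xs"
  shows "next_row (xs ! i) (drop (Suc i) xs) (xs ! (i + l)) (drop (Suc (i + l)) xs)
      (window xs l i) (window xs l (Suc i)) (map (window xs l) [Suc (Suc i)..<Suc (length xs) - l])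
    = map (window xs (Suc (Suc l))) [i..<length xs - Suc l]"
  using assms
proof (induction "length xs - (i + l)" arbitrary: i)
  case 0
  then show ?case by simp
next
  case (Suc k)
  show ?case
  proof (cases "Suc (i + l) < length xs")
    case False
    then have "length xs = Suc (i + l)" using Suc by simp
    then show ?thesis by (cases "drop (Suc i) xs") simp_all
  next
    case True
    have a: "drop (Suc i) xs = xs ! Suc i # drop (Suc (Suc i)) xs"
      "drop (Suc (i + l)) xs = xs ! (Suc i + l) # drop (Suc (Suc i + l)) xs"
      using True by (simp_all add: Cons_nth_drop_Suc)
    have b: "[Suc (Suc i)..<Suc (length xs) - l] = Suc (Suc i) # [Suc (Suc (Suc i))..<Suc (length xs) - l]"
      "[i..<length xs - Suc l] = i # [Suc i..<length xs - Suc l]"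
      using True by (subst upt_conv_Cons; simp)+
    have "k = length xs - (Suc i + l)" using Suc by simp
    then have IH: "next_row (xs ! Suc i) (drop (Suc (Suc i)) xs) (xs ! (Suc i + l)) (drop (Suc (Suc i + l)) xs)
      (window xs l (Suc i)) (window xs l (Suc (Suc i))) (map (window xs l) [Suc (Suc (Suc i))..<Suc (length xs) - l])
      = map (window xs (Suc (Suc l))) [Suc i..<length xs - Suc l]"
      using True by (intro Suc.hyps(1)) simp_all
    have "i + Suc (Suc l) \<le> length xs" using True by simp
    then show ?thesis
      unfolding a b list.map next_row.simps IH nat_min_eq nat_max_eq add_bool_eq
      by (simp only: window_step add_Suc add_Suc_right)
  qed
qed

text \<open>Induction on the number \<open>k\<close> of rows still to compute; for
  \<open>k = 0\<close> the only window is the whole path.\<close>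

lemma rows_window:
  assumes "length xs = l + 2 * k" "xs = a # as"
  shows "rows a as (drop l xs) (map (window xs l) [0..<Suc (length xs) - l]) = path_count Bob xs"
  using assms(1)
proof (induction k arbitrary: l)
  case 0
  then show ?case by (simp add: window_def)
next
  case (Suc k)
  have d: "drop l xs = xs ! l # xs ! Suc l # drop (Suc (Suc l)) xs"
    using Suc.prems by (simp add: Cons_nth_drop_Suc)
  have m: "map (window xs l) [0..<Suc (length xs) - l] =
      window xs l 0 # window xs l (Suc 0) # map (window xs l) [Suc (Suc 0)..<Suc (length xs) - l]"
    using Suc.prems by (simp add: upt_conv_Cons del: upt_Suc)
  have "xs ! l = xs ! (0 + l)" "xs ! Suc l # drop (Suc (Suc l)) xs = drop (Suc (0 + l)) xs"
    "a = xs ! 0" "as = drop (Suc 0) xs"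
    using Suc.prems assms(2) Cons_nth_drop_Suc[of "Suc l" xs] by auto
  then have "next_row a as (xs ! l) (xs ! Suc l # drop (Suc (Suc l)) xs) (window xs l 0) (window xs l (Suc 0))
      (map (window xs l) [Suc (Suc 0)..<Suc (length xs) - l])
    = map (window xs (Suc (Suc l))) [0..<Suc (length xs) - Suc (Suc l)]"
    using next_row_window[of 0 l xs] Suc.prems by simp
  then show ?case
    unfolding d m rows.simps using Suc.IH[of "Suc (Suc l)"] Suc.prems by simp
qed

lemma path_count_rows:
  assumes "even (length xs)"
  shows "path_count_rows xs = path_count Bob xs"
proof (cases xs)
  case (Cons a as)
  have "window xs 0 = (\<lambda>_. 0)" by (simp add: window_def fun_eq_iff)
  then have "map (window xs 0) [0..<Suc (length xs)] = replicate (Suc (length xs)) 0"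
    by (simp only: map_replicate_const length_upt diff_zero)
  then show ?thesis
    using rows_window[of xs 0 "length xs div 2" a as] assms Cons
    unfolding path_count_rows_def by (simp del: upt_Suc)
qed (simp add: path_count_rows_def)

section \<open>The search\<close>

abbreviation trues :: "bool list \<Rightarrow> nat" where
  "trues xs \<equiv> count_list xs True"

text \<open>The default \<open>False\<close> for \<open>r\<close> past the end of \<open>w\<close>
  lets \<open>not_wins_from_any\<close> hold for arbitrary lists of starts.\<close>

definition wins_from :: "nat \<Rightarrow> bool list \<Rightarrow> nat \<Rightarrow> bool" where
  "wins_from t w r = (case drop r w of [] \<Rightarrow> False
     | x # xs \<Rightarrow> \<not> nat_le (add_bool x (path_count_rows (xs @ take r w))) t)"

fun wins_from_any :: "nat \<Rightarrow> bool list \<Rightarrow> nat list \<Rightarrow> bool" where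
  "wins_from_any t w [] = False"
| "wins_from_any t w (r # rs) = (if wins_from t w r then True else wins_from_any t w rs)"

definition settled :: "nat list \<Rightarrow> bool list list \<Rightarrow> nat \<Rightarrow> bool list \<Rightarrow> bool" where
  "settled rs ex t w = (if wins_from_any t w rs then True else w \<in> set ex)"

text \<open>Rebuilds the circle in front of \<open>acc\<close> from its even positions (first list)
  and odd positions (second list), both given last to first.\<close>

fun interleave_rev :: "bool list \<Rightarrow> bool list \<Rightarrow> bool list \<Rightarrow> bool list" where
  "interleave_rev (p # ps) (q # qs) acc = interleave_rev ps qs (p # q # acc)"
| "interleave_rev ps qs acc = acc"

text \<open>Both lists are reversed, so their tails are prefixes of the circle. \<open>rises\<close> asks for a prefix
  in which the odd positions \<open>qs\<close> have no more ones than the even ones \<open>ps\<close>, and \<open>drops\<close> for a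
  shorter one in which they have \<open>d\<close> more, the next even slice included. These conditions say that
  certain half circles are light.\<close>

fun drops :: "nat \<Rightarrow> bool list \<Rightarrow> bool list \<Rightarrow> bool" where
  "drops d (p # ps) (q # qs) \<longleftrightarrow> d + trues (p # ps) \<le> trues qs \<or> drops d ps qs"
| "drops d ps qs \<longleftrightarrow> False"

fun rises :: "nat \<Rightarrow> bool list \<Rightarrow> bool list \<Rightarrow> bool" where
  "rises d (p # ps) (q # qs) \<longleftrightarrow>
     trues (q # qs) \<le> trues (p # ps) \<and> drops d (p # ps) (q # qs) \<or> rises d ps qs"
| "rises d ps qs \<longleftrightarrow> False"

text \<open>The searches build the circle from the back: \<open>n\<close> pairs are still to be placed, with \<open>a\<close> ones at
  even and \<open>b\<close> ones at odd positions, and \<open>acc\<close> is what has been placed. Conditionals take the place of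
  conjunctions where the second argument must not be evaluated.\<close>

fun search_free :: "nat list \<Rightarrow> bool list list \<Rightarrow> nat \<Rightarrow> nat \<Rightarrow> nat \<Rightarrow> nat \<Rightarrow> bool list \<Rightarrow> bool" where
  "search_free rs ex t 0 a b acc = (if a = 0 then if b = 0 then settled rs ex t acc else True else True)"
| "search_free rs ex t (Suc n) a b acc =
    (if nat_le a (Suc n) then if nat_le b (Suc n) then
       search_free rs ex t n a b (False # False # acc) \<and>
       (case b of 0 \<Rightarrow> True | Suc b' \<Rightarrow> search_free rs ex t n a b' (False # True # acc)) \<and>
       (case a of 0 \<Rightarrow> True | Suc a' \<Rightarrow> search_free rs ex t n a' b (True # False # acc) \<and>
         (case b of 0 \<Rightarrow> True | Suc b' \<Rightarrow> search_free rs ex t n a' b' (True # True # acc)))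
     else True else True)"

text \<open>Restricts the search to patterns satisfying \<open>drops\<close>. As soon as the pair
  being placed witnesses the drop, the shorter prefix is unconstrained and
  \<open>search_free\<close> takes over; \<open>drops_le\<close> justifies the pruning by
  \<open>d \<le> b\<close>.\<close>

fun search_drop :: "nat list \<Rightarrow> bool list list \<Rightarrow> nat \<Rightarrow> nat \<Rightarrow> nat \<Rightarrow> nat \<Rightarrow> nat \<Rightarrow> bool list \<Rightarrow> bool" where
  "search_drop rs ex t d 0 a b acc = True"
| "search_drop rs ex t d (Suc n) a b acc =
    (if nat_le d b then if nat_le a (Suc n) then if nat_le b (Suc n) then
       (if nat_le (d + a) b then search_free rs ex t n a b (False # False # acc)
        else search_drop rs ex t d n a b (False # False # acc)) \<and>
       (case b of 0 \<Rightarrow> True | Suc b' \<Rightarrow>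
         if nat_le (d + a) b' then search_free rs ex t n a b' (False # True # acc)
         else search_drop rs ex t d n a b' (False # True # acc)) \<and>
       (case a of 0 \<Rightarrow> True | Suc a' \<Rightarrow>
         (if nat_le (d + a) b then search_free rs ex t n a' b (True # False # acc)
          else search_drop rs ex t d n a' b (True # False # acc)) \<and>
         (case b of 0 \<Rightarrow> True | Suc b' \<Rightarrow>
           if nat_le (d + a) b' then search_free rs ex t n a' b' (True # True # acc)
           else search_drop rs ex t d n a' b' (True # True # acc)))
     else True else True else True)"

text \<open>Restricts the search to patterns satisfying \<open>rises\<close>: at the first prefix
  with \<open>b \<le> a\<close> the rise has been found, and only a drop inside that prefix remains
  to be demanded.\<close>

fun search_rise :: "nat list \<Rightarrow> bool list list \<Rightarrow> nat \<Rightarrow> nat \<Rightarrow> nat \<Rightarrow> nat \<Rightarrow> nat \<Rightarrow> bool list \<Rightarrow> bool" where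
  "search_rise rs ex t d 0 a b acc = True"
| "search_rise rs ex t d (Suc n) a b acc =
    (if nat_le b a then search_drop rs ex t d (Suc n) a b acc
     else if nat_le d b then if nat_le a (Suc n) then if nat_le b (Suc n) then
       search_rise rs ex t d n a b (False # False # acc) \<and>
       (case b of 0 \<Rightarrow> True | Suc b' \<Rightarrow> search_rise rs ex t d n a b' (False # True # acc)) \<and>
       (case a of 0 \<Rightarrow> True | Suc a' \<Rightarrow> search_rise rs ex t d n a' b (True # False # acc) \<and>
         (case b of 0 \<Rightarrow> True | Suc b' \<Rightarrow> search_rise rs ex t d n a' b' (True # True # acc)))
     else True else True else True)"

text \<open>Slice 20 is fixed as a zero and slice 19 as a one; the branch is over slice 18, the last
  even position. Hence \<open>b\<close> counts only the nine odd positions before 19.\<close>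

definition search :: "nat list \<Rightarrow> bool list list \<Rightarrow> nat \<Rightarrow> nat \<Rightarrow> nat \<Rightarrow> nat \<Rightarrow> bool" where
  "search rs ex t d a b =
    (search_rise rs ex t d 9 a b [False, True, False] \<and>
     (case a of 0 \<Rightarrow> True | Suc a' \<Rightarrow> search_rise rs ex t d 9 a' b [True, True, False]))"

section \<open>Soundness of the searches\<close>

lemma drops_le: "drops d ps qs \<Longrightarrow> d \<le> trues qs"
  by (induction d ps qs rule: drops.induct) (auto split: if_splits)

lemma rises_drops: "rises d ps qs \<Longrightarrow> drops d ps qs"
  by (induction d ps qs rule: rises.induct) auto

text \<open>A list has at most as many ones as entries, so the guards never cut off an actual
  pattern, and the call for its next pair is among those checked.\<close>

lemma search_free:
  "search_free rs ex t n (trues ps) (trues qs) acc \<Longrightarrow> length ps = n \<Longrightarrow> length qs = n \<Longrightarrow>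
    settled rs ex t (interleave_rev ps qs acc)"
proof (induction n arbitrary: ps qs acc)
  case (Suc n)
  then obtain p ps' q qs' where e: "ps = p # ps'" "qs = q # qs'" "length ps' = n" "length qs' = n"
    by (auto simp: length_Suc_conv)
  have "trues ps \<le> Suc n" "trues qs \<le> Suc n" using Suc.prems count_le_length[of _ True] by metis+
  then have "search_free rs ex t n (trues ps') (trues qs') (p # q # acc)"
    using Suc.prems(1) by (cases p; cases q) (simp_all add: e nat_le_eq)
  then show ?case using Suc.IH e by simp
qed simp

lemma search_drop:
  "search_drop rs ex t d n (trues ps) (trues qs) acc \<Longrightarrow> length ps = n \<Longrightarrow> length qs = n \<Longrightarrow>
    drops d ps qs \<Longrightarrow> settled rs ex t (interleave_rev ps qs acc)"
proof (induction n arbitrary: ps qs acc)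
  case (Suc n)
  then obtain p ps' q qs' where e: "ps = p # ps'" "qs = q # qs'" "length ps' = n" "length qs' = n"
    by (auto simp: length_Suc_conv)
  have "trues ps \<le> Suc n" "trues qs \<le> Suc n" using Suc.prems count_le_length[of _ True] by metis+
  then have "if d + trues ps \<le> trues qs' then search_free rs ex t n (trues ps') (trues qs') (p # q # acc)
      else search_drop rs ex t d n (trues ps') (trues qs') (p # q # acc)"
    using Suc.prems(1) drops_le[OF Suc.prems(4)]
    by (cases p; cases q) (simp_all add: e nat_le_eq split: if_splits)
  moreover have "d + trues ps \<le> trues qs' \<or> drops d ps' qs'" using Suc.prems(4) by (simp add: e)
  ultimately show ?case using Suc.IH[of ps' qs'] search_free e by (auto split: if_splits)
qed simp

lemma search_rise:
  "search_rise rs ex t d n (trues ps) (trues qs) acc \<Longrightarrow> length ps = n \<Longrightarrow> length qs = n \<Longrightarrow>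
    rises d ps qs \<Longrightarrow> settled rs ex t (interleave_rev ps qs acc)"
proof (induction n arbitrary: ps qs acc)
  case (Suc n)
  then obtain p ps' q qs' where e: "ps = p # ps'" "qs = q # qs'" "length ps' = n" "length qs' = n"
    by (auto simp: length_Suc_conv)
  have d: "drops d ps qs" using Suc.prems(4) by (rule rises_drops)
  show ?case
  proof (cases "trues qs \<le> trues ps")
    case True
    then show ?thesis using Suc.prems search_drop[OF _ Suc.prems(2,3) d] by (simp add: nat_le_eq)
  next
    case False
    have "trues ps \<le> Suc n" "trues qs \<le> Suc n" using Suc.prems count_le_length[of _ True] by metis+
    then have "search_rise rs ex t d n (trues ps') (trues qs') (p # q # acc)"
      using Suc.prems(1) drops_le[OF d] False
      by (cases p; cases q) (simp_all add: e nat_le_eq)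
    moreover have "rises d ps' qs'" using Suc.prems(4) False unfolding e rises.simps by blast
    ultimately show ?thesis using Suc.IH[of ps' qs'] e by simp
  qed
qed simp

lemma search:
  assumes "search rs ex t d (trues ps) (trues qs)" "length ps = 10" "length qs = 9"
    "rises d ps (True # qs)" "trues ps \<le> trues qs"
  shows "settled rs ex t (interleave_rev ps (True # qs) [False])"
proof -
  obtain p ps' where ps: "ps = p # ps'" "length ps' = 9"
    using assms(2) by (auto simp: length_Suc_conv numeral_eq_Suc)
  have "search_rise rs ex t d 9 (trues ps') (trues qs) [p, True, False]"
    using assms(1) unfolding search_def by (cases p) (simp_all add: ps)
  \<comment> \<open>The full prefix cannot be the rise: \<open>True # qs\<close> has more ones than
    \<open>ps\<close>.\<close>
  moreover have "rises d ps' qs"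
    using assms(4,5) by (simp add: ps split: if_splits)
  ultimately show ?thesis using search_rise[OF _ ps(2) assms(3)] by (simp add: ps)
qed

text \<open>Removing last entries until the even prefix has length \<open>Suc i\<close> exposes the
  witness for the recursive predicate.\<close>

lemma drops_rev:
  "length ps = n \<Longrightarrow> length qs = n \<Longrightarrow> i < n \<Longrightarrow>
    d + trues (take (Suc i) ps) \<le> trues (take i qs) \<Longrightarrow> drops d (rev ps) (rev qs)"
proof (induction n arbitrary: ps qs)
  case (Suc n)
  from Suc.prems(1,2) obtain p ps' q qs' where e: "ps = ps' @ [p]" "qs = qs' @ [q]"
    by (metis length_Suc_conv_rev)
  show ?case
  proof (cases "i = n")
    case True
    then have "take (Suc i) ps = ps" "take i qs = qs'" using Suc.prems e by auto
    then show ?thesis using Suc.prems(4) by (simp add: e count_list_rev split: if_splits)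
  next
    case False
    then have "drops d (rev ps') (rev qs')" using Suc.prems e by (intro Suc.IH) auto
    then show ?thesis by (simp add: e)
  qed
qed simp

lemma rises_rev:
  "length ps = n \<Longrightarrow> length qs = n \<Longrightarrow> i < j \<Longrightarrow> j \<le> n \<Longrightarrow>
    d + trues (take (Suc i) ps) \<le> trues (take i qs) \<Longrightarrow> trues (take j qs) \<le> trues (take j ps) \<Longrightarrow>
    rises d (rev ps) (rev qs)"
proof (induction n arbitrary: ps qs)
  case (Suc n)
  from Suc.prems(1,2) obtain p ps' q qs' where e: "ps = ps' @ [p]" "qs = qs' @ [q]"
    by (metis length_Suc_conv_rev)
  show ?case
  proof (cases "j = Suc n")
    case True
    then have "trues (rev qs) \<le> trues (rev ps)" using Suc.prems by (simp add: count_list_rev)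
    moreover have "drops d (rev ps) (rev qs)" using drops_rev[OF Suc.prems(1,2) _ Suc.prems(5)] Suc.prems(3,4) by simp
    ultimately show ?thesis by (simp only: e rev_append rev.simps append.simps rises.simps simp_thms)
  next
    case False
    then have "rises d (rev ps') (rev qs')" using Suc.prems e by (intro Suc.IH) auto
    then show ?thesis by (simp add: e)
  qed
qed simp

section \<open>Alice's first moves on a 0/1 circle\<close>

definition first_value :: "bool list \<Rightarrow> nat" where
  "first_value w = of_bool (hd w) + path_count Bob (tl w)"

text \<open>Letting \<open>r\<close> range over all naturals makes the notion invariant under
  rotation at once; modulo the length only finitely many conditions remain.\<close>

definition Alice_bounded :: "nat \<Rightarrow> bool list \<Rightarrow> bool" where
  "Alice_bounded t w \<longleftrightarrow> (\<forall>r. first_value (rotate r w) \<le> t)"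

lemma Alice_bounded_rotate: "Alice_bounded t w \<Longrightarrow> Alice_bounded t (rotate m w)"
  by (simp add: Alice_bounded_def rotate_rotate)

lemma wins_from_iff:
  assumes "r < length w" "odd (length w)"
  shows "wins_from t w r \<longleftrightarrow> t < first_value (rotate r w)"
proof -
  obtain x xs where d: "drop r w = x # xs" using assms(1) by (metis Cons_nth_drop_Suc)
  then have r: "rotate r w = x # xs @ take r w" using assms(1) by (simp add: rotate_drop_take)
  then have "length w = Suc (length (xs @ take r w))" by (metis length_Cons length_rotate)
  then have "even (length (xs @ take r w))" using assms(2) by (metis even_Suc)
  then show ?thesis
    unfolding wins_from_def d r first_value_def
    by (simp add: nat_le_eq add_bool_eq path_count_rows not_le)
qed

lemma not_wins_from_any:
  assumes "Alice_bounded t w" "odd (length w)"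
  shows "\<not> wins_from_any t w rs"
proof (induction rs)
  case (Cons r rs)
  have "\<not> wins_from t w r"
  proof (cases "r < length w")
    case True
    then show ?thesis using wins_from_iff[OF True assms(2)] assms(1)
      by (auto simp: Alice_bounded_def not_less)
  next
    case False
    then show ?thesis by (simp add: wins_from_def)
  qed
  then show ?case using Cons by simp
qed simp

lemma wins_from_anyI: "wins_from t w r \<Longrightarrow> r \<in> set rs \<Longrightarrow> wins_from_any t w rs"
  by (induction rs) auto

lemma Alice_boundedI:
  assumes "\<not> wins_from_any t w rs" "{..<length w} \<subseteq> set rs" "odd (length w)"
  shows "Alice_bounded t w"
  unfolding Alice_bounded_def
proof
  fix r
  have n: "r mod length w < length w" using assms(3) by (auto intro: mod_less_divisor odd_pos)
  then have "\<not> wins_from t w (r mod length w)"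
    using assms(1,2) wins_from_anyI by blast
  then show "first_value (rotate r w) \<le> t"
    using wins_from_iff[OF n assms(3)] by (simp add: rotate_conv_mod[of r] not_less)
qed

lemma tl_rotate:
  assumes "w \<noteq> []"
  shows "tl (rotate r w) = map (\<lambda>j. w ! ((r + j) mod length w)) [1..<length w]"
  using assms by (intro nth_equalityI) (auto simp: nth_tl nth_rotate)

lemma hd_rotate: "w \<noteq> [] \<Longrightarrow> hd (rotate r w) = w ! (r mod length w)"
  by (simp add: hd_rotate_conv_nth)

lemma sum_list_two_sizes:
  fixes x c :: real
  shows "sum_list (map (\<lambda>b. x + c * of_bool b) w) = x * real (length w) + c * real (trues w)"
  by (induction w) (auto simp: algebra_simps)

text \<open>Alice takes 11 of the 21 slices in every play, which contributes \<open>11 * x\<close>;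
  a gain of 5/9 for Bob leaves her at most 4/9 of the total.\<close>

lemma two_sizes_Bob_gain_iff:
  fixes x c :: real
  assumes "c \<ge> 0" "length w = 21"
  defines "P \<equiv> map (\<lambda>b. x + c * of_bool b) w"
  shows "(\<exists>\<sigma>. has_gain P Bob \<sigma> (5 * sum_list P / 9)) \<longleftrightarrow>
    (\<forall>r<21. 11 * x + c * real (first_value (rotate r w)) \<le> 4 / 9 * (21 * x + c * real (trues w)))"
proof -
  have ne: "w \<noteq> []" using assms(2) by auto
  have "P ! r + path_value Bob (arc_rest P r 1) = 11 * x + c * real (first_value (rotate r w))"
    if "r < 21" for r
  proof -
    have "arc_rest P r 1 = map (\<lambda>b. x + c * of_bool b) (tl (rotate r w))"
      unfolding arc_rest_def tl_rotate[OF ne] P_def using assms(2) by simp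
    moreover have "path_value Bob (map (\<lambda>b. x + c * of_bool b) (tl (rotate r w))) =
        10 * x + c * real (path_count Bob (tl (rotate r w)))"
      using assms(2) by (subst path_value_affine[OF assms(1)]) simp
    moreover have "P ! r = x + c * of_bool (hd (rotate r w))"
      using that assms(2) by (simp add: P_def hd_rotate[OF ne])
    ultimately show ?thesis by (simp add: first_value_def algebra_simps)
  qed
  moreover have "sum_list P - 5 * sum_list P / 9 = 4 / 9 * (21 * x + c * real (trues w))"
    unfolding P_def sum_list_two_sizes using assms(2) by (simp add: field_simps)
  moreover have "P \<noteq> []" "length P = 21" using ne assms(2) by (simp_all add: P_def)
  ultimately show ?thesis by (simp add: Bob_gain_iff)
qed

section \<open>Half circles\<close>

declare sum_of_bool_eq [simp del]

text \<open>Since 2 generates the integers modulo 21, the slices 0, 2, 4, ... form a second circle; a half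
  circle consists of 11 consecutive slices of it. A player who always answers on the side where the
  opponent has just opened the path collects such a half circle.\<close>

definition half_circle :: "bool list \<Rightarrow> nat \<Rightarrow> nat" where
  "half_circle w u = (\<Sum>j<11. of_bool (w ! ((2 * (u + j)) mod 21)))"

lemma sum_lessThan_add:
  fixes f :: "nat \<Rightarrow> nat"
  shows "(\<Sum>i<m + n. f i) = (\<Sum>i<m. f i) + (\<Sum>i<n. f (m + i))"
  by (induction n) auto

lemma half_circle_add_21: "half_circle w (u + 21) = half_circle w u"
proof -
  have "2 * (u + 21 + j) mod 21 = 2 * (u + j) mod 21" for j
  proof -
    have "2 * (u + 21 + j) = 2 * (u + j) + 2 * 21" by simp
    then show ?thesis by (simp only: mod_mult_self1)
  qed
  then show ?thesis by (simp only: half_circle_def)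
qed

lemma half_circle_rotate:
  assumes "length w = 21"
  shows "half_circle (rotate (2 * a) w) u = half_circle w (u + a)"
proof -
  have "rotate (2 * a) w ! (2 * (u + j) mod 21) = w ! (2 * (u + a + j) mod 21)" for j
  proof -
    have "2 * a + 2 * (u + j) = 2 * (u + a + j)" by simp
    then have "(2 * a + 2 * (u + j) mod 21) mod 21 = 2 * (u + a + j) mod 21"
      by (simp only: mod_add_right_eq)
    then show ?thesis using assms by (simp add: nth_rotate)
  qed
  then show ?thesis by (simp only: half_circle_def)
qed

text \<open>Starting at slice \<open>2 * v\<close> and answering on Bob's side, Alice gets the
  slices with indices \<open>v + l + 11\<close>, ..., \<open>v + 20\<close> on the second circle
  from the right part, then \<open>v + 21\<close>, which is her first slice, and the next
  \<open>l\<close> from the left part: 11 consecutive ones.\<close>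

lemma half_circle_le_first_value:
  assumes "length w = 21"
  shows "\<exists>l\<le>10. half_circle w (v + l + 11) \<le> first_value (rotate (2 * v) w)"
proof -
  let ?f = "\<lambda>u. of_bool (w ! (2 * u mod 21)) :: nat" and ?xs = "tl (rotate (2 * v) w)"
  have ne: "w \<noteq> []" using assms by auto
  have x: "?xs ! i = w ! ((2 * v + 1 + i) mod 21)" if "i < 20" for i
    using that assms unfolding tl_rotate[OF ne] by simp
  have "length ?xs = 2 * 10" using assms by simp
  then obtain l where l: "l \<le> 10"
    "(\<Sum>i<l. of_bool (?xs ! (2 * i + 1))) + (\<Sum>i=l..<10. of_bool (?xs ! (2 * i))) \<le> path_count Bob ?xs"
    using path_count_follow by blast
  have "half_circle w (v + l + 11) = (\<Sum>j<(10 - l) + Suc l. ?f (v + l + 11 + j))"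
    using l(1) by (simp add: half_circle_def)
  also have "\<dots> = (\<Sum>j<10 - l. ?f (v + l + 11 + j)) + (\<Sum>j<Suc l. ?f (v + l + 11 + (10 - l + j)))"
    by (rule sum_lessThan_add)
  also have "(\<Sum>j<10 - l. ?f (v + l + 11 + j)) = (\<Sum>i=l..<10. of_bool (?xs ! (2 * i)))"
  proof -
    have "2 * (v + l + 11 + j) mod 21 = (2 * v + 1 + 2 * (l + j)) mod 21" for j
    proof -
      \<comment> \<open>Adding 21 turns the odd offset from \<open>2 * v\<close> into an even one
        without changing the slice.\<close>
      have "2 * (v + l + 11 + j) = 2 * v + 1 + 2 * (l + j) + 21" by simp
      then show ?thesis by (simp only: mod_add_self2)
    qed
    then have "?f (v + l + 11 + j) = of_bool (?xs ! (2 * (l + j)))" if "j < 10 - l" for j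
      using that by (simp add: x)
    then show ?thesis by (simp add: sum.atLeastLessThan_shift_0[of _ l] atLeast0LessThan)
  qed
  also have "(\<Sum>j<Suc l. ?f (v + l + 11 + (10 - l + j))) = (\<Sum>j<Suc l. ?f (v + j))"
  proof (rule sum.cong)
    fix j
    have "2 * (v + l + 11 + (10 - l + j)) = 2 * (v + j) + 2 * 21" using l(1) by simp
    then show "?f (v + l + 11 + (10 - l + j)) = ?f (v + j)" by (simp only: mod_mult_self1)
  qed simp
  also have "\<dots> = ?f v + (\<Sum>j<l. ?f (v + Suc j))" by (simp add: sum.lessThan_Suc_shift del: sum.lessThan_Suc)
  also have "(\<Sum>j<l. ?f (v + Suc j)) = (\<Sum>i<l. of_bool (?xs ! (2 * i + 1)))"
    using l(1) by (intro sum.cong) (auto simp: x)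
  finally have "half_circle w (v + l + 11) \<le> ?f v + path_count Bob ?xs" using l(2) by simp
  then show ?thesis using l(1) assms by (auto simp: first_value_def hd_rotate[OF ne])
qed

lemma trues_map_upt: "trues (map g [0..<n]) = (\<Sum>i<n. of_bool (g i))"
  by (induction n) auto

lemma list_21: "length w = 21 \<Longrightarrow> w = map ((!) w) [0..<21]"
  by (metis map_nth)

text \<open>Doubling permutes the residues modulo 21; the case \<open>j = 0\<close> is enumerated,
  and shifting \<open>j\<close> only rotates the sum.\<close>

lemma sum_cycle:
  fixes g :: "nat \<Rightarrow> nat"
  shows "(\<Sum>u<21. g (2 * (u + j) mod 21)) = (\<Sum>u<21. g u)"
proof (induction j)
  case 0
  show ?case by (simp add: lessThan_nat_numeral lessThan_Suc)
next
  case (Suc j)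
  let ?g = "\<lambda>u. g (2 * (u + j) mod 21)"
  have "(\<Sum>u<Suc 21. ?g u) = ?g 0 + (\<Sum>u<21. ?g (Suc u))"
    by (rule sum.lessThan_Suc_shift)
  moreover have "(\<Sum>u<Suc 21. ?g u) = (\<Sum>u<21. ?g u) + ?g 21"
    by (rule sum.lessThan_Suc)
  moreover have "?g 21 = ?g 0"
  proof -
    have "2 * (21 + j) = 2 * (0 + j) + 2 * 21" by simp
    then show ?thesis by (simp only: mod_mult_self1)
  qed
  moreover have "(\<Sum>u<21. ?g (Suc u)) = (\<Sum>u<21. g (2 * (u + Suc j) mod 21))"
    by (simp only: add_Suc add_Suc_right)
  ultimately show ?case using Suc by linarith
qed

lemma trues_conv_sum:
  assumes "length w = 21"
  shows "trues w = (\<Sum>u<21. of_bool (w ! u))"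
  using trues_map_upt[of "(!) w" 21] unfolding list_21[OF assms, symmetric] .

text \<open>Every slice lies in 11 of the 21 half circles, so they hold \<open>11 * trues w\<close>
  ones in total, which exceeds \<open>21 * t\<close>: some half circle is heavy. Some other is
  light, so going round a heavy one is directly followed by a light one.\<close>

lemma half_circle_threshold:
  assumes "length w = 21" "9 * t \<le> 4 * trues w" "0 < trues w" "Alice_bounded t w"
  shows "\<exists>a. half_circle w a > t \<and> half_circle w (a + 1) \<le> t"
proof -
  have per: "half_circle w (u + 21 * n) = half_circle w u" for u n
  proof (induction n)
    case (Suc n)
    have "u + 21 * Suc n = (u + 21 * n) + 21" by simp
    then show ?case by (simp only: half_circle_add_21 Suc)
  qed simp
  obtain b where b: "half_circle w b \<le> t"
    using half_circle_le_first_value[OF assms(1), of 0] assms(4) unfolding Alice_bounded_def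
    by (meson order_trans)
  have "(\<Sum>u<21. half_circle w u) = (\<Sum>j<11. \<Sum>u<21. of_bool (w ! (2 * (u + j) mod 21)))"
    unfolding half_circle_def by (rule sum.swap)
  also have "\<dots> = 11 * trues w" 
    by (simp only: sum_cycle[of "\<lambda>i. of_bool (w ! i)"] trues_conv_sum[OF assms(1)] sum_constant card_lessThan of_nat_id)
  finally have "\<not> (\<forall>u<21. half_circle w u \<le> t)"
    using sum_bounded_above[of "{..<21}" "half_circle w" t] assms(2,3) by auto
  then obtain a where a: "half_circle w a > t" by (meson not_le)
  show ?thesis
  proof (rule ccontr)
    assume "\<not> ?thesis"
    then have "half_circle w u > t \<Longrightarrow> half_circle w (Suc u) > t" for u by (auto simp: not_le)
    then have "half_circle w (a + n) > t" for n using a by (induction n) auto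
    \<comment> \<open>\<open>a + (b + 20 * a)\<close> is \<open>b\<close> plus \<open>a\<close> full
      turns, and the half circle at \<open>b\<close> is light.\<close>
    from this[of "b + 20 * a"] show False using b per[of b a] by (simp add: algebra_simps)
  qed
qed

text \<open>With prefix counts \<open>p\<close> of the even and \<open>q\<close> of the odd
  positions, lightness of the half circle at \<open>j \<le> 10\<close> means
  \<open>q j \<le> p j\<close>, and at \<open>11 + i\<close> it means
  \<open>trues w - 2 * t + p (Suc i) \<le> q i\<close>. The light half circles around the odd slices
  yield a drop followed by a rise.\<close>

lemma half_circle_path:
  assumes w: "length w = 21" and "half_circle w 0 \<le> t" "t < half_circle w 20" "Alice_bounded t w"
    and t: "9 * t \<le> 4 * trues w" "0 < trues w"
  defines "ps \<equiv> map (\<lambda>u. w ! (2 * u)) [0..<10]" and "qs \<equiv> map (\<lambda>u. w ! (2 * u + 1)) [0..<10]"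
  shows "w = interleave_rev (rev ps) (rev qs) [False]" "w ! 19" "trues ps = t" "trues qs = trues w - t"
    "rises (trues w - 2 * t) (rev ps) (rev qs)"
proof -
  let ?f = "\<lambda>u. of_bool (w ! (2 * u mod 21)) :: nat"
  define p q where "p i = (\<Sum>u<i. ?f u)" and "q i = (\<Sum>u<i. ?f (11 + u))" for i
  have G: "half_circle w u = (\<Sum>j<11. ?f (u + j))" for u by (simp add: half_circle_def)
  have f: "?f (21 + u) = ?f u" for u
  proof -
    have "2 * (21 + u) = 2 * u + 2 * 21" by simp
    then have "2 * (21 + u) mod 21 = 2 * u mod 21" by (simp only: mod_mult_self1)
    then show ?thesis by simp
  qed
  have p10: "p 11 = half_circle w 0" by (simp add: G p_def)
  have low: "p j + half_circle w j = half_circle w 0 + q j" for j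
  proof -
    have "p j + half_circle w j = (\<Sum>u<j + 11. ?f u)"
      unfolding p_def G by (rule sum_lessThan_add[symmetric])
    also have "\<dots> = (\<Sum>u<11 + j. ?f u)" by (simp only: add.commute)
    also have "\<dots> = half_circle w 0 + q j"
      unfolding q_def p10[symmetric] p_def by (rule sum_lessThan_add)
    finally show ?thesis .
  qed
  have high: "q i + half_circle w (11 + i) = q 10 + p (Suc i)" for i
  proof -
    have "q i + half_circle w (11 + i) = (\<Sum>u<i + 11. ?f (11 + u))"
      unfolding q_def G by (simp only: sum_lessThan_add add.assoc)
    also have "i + 11 = 10 + Suc i" by simp
    also have "(\<Sum>u<10 + Suc i. ?f (11 + u)) = q 10 + (\<Sum>u<Suc i. ?f (11 + (10 + u)))"
      unfolding q_def by (rule sum_lessThan_add)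
    also have "(\<Sum>u<Suc i. ?f (11 + (10 + u))) = p (Suc i)"
    proof -
      have "11 + (10 + u) = 21 + u" for u :: nat by simp
      then show ?thesis unfolding p_def by (simp only: f)
    qed
    finally show ?thesis .
  qed
  have tot: "half_circle w 0 + q 10 = trues w"
  proof -
    have "half_circle w 0 + q 10 = (\<Sum>u<11 + 10. ?f u)"
      unfolding p10[symmetric] p_def q_def by (rule sum_lessThan_add[symmetric])
    also have "11 + 10 = (21 :: nat)" by simp
    also have "(\<Sum>u<21. ?f u) = trues w"
      using sum_cycle[of "\<lambda>i. of_bool (w ! i)" 0]
      by (simp only: add_0_right trues_conv_sum[OF w])
    finally show ?thesis .
  qed
  have "p (Suc 10) = p 10 + ?f 10" "q (Suc 9) = q 9 + ?f (11 + 9)"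
    by (simp_all only: p_def q_def sum.lessThan_Suc)
  then have "p 11 = p 10 + of_bool (w ! 20)" "q 10 = q 9 + of_bool (w ! 19)" by simp_all
  moreover from this(2) have "half_circle w 20 = of_bool (w ! 19) + p 10"
    using high[of 9] by simp
  \<comment> \<open>The half circles at 0 and 20 share the ten slices counted by \<open>p 10\<close>
    and differ only in slices 20 and 19, so light against heavy determines both.\<close>
  ultimately have H: "w ! 19" "\<not> w ! 20" "p 10 = t" "half_circle w 0 = t"
    using assms(2,3) p10 by (cases "w ! 19"; cases "w ! 20"; simp)+
  then show "w ! 19" by simp
  have tp: "trues (take i ps) = p i" if "i \<le> 10" for i
  proof -
    have "take i ps = map (\<lambda>u. w ! (2 * u)) [0..<i]" using that by (simp add: ps_def take_map)
    then have "trues (take i ps) = (\<Sum>u<i. of_bool (w ! (2 * u)))" by (simp add: trues_map_upt)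
    also have "\<dots> = p i" unfolding p_def using that by (intro sum.cong) auto
    finally show ?thesis .
  qed
  have tq: "trues (take i qs) = q i" if "i \<le> 10" for i
  proof -
    have "take i qs = map (\<lambda>u. w ! (2 * u + 1)) [0..<i]" using that by (simp add: qs_def take_map)
    then have "trues (take i qs) = (\<Sum>u<i. of_bool (w ! (2 * u + 1)))" by (simp add: trues_map_upt)
    also have "\<dots> = q i" unfolding q_def
    proof (rule sum.cong)
      fix u assume "u \<in> {..<i}"
      then have "2 * (11 + u) = (2 * u + 1) + 21" "2 * u + 1 < 21" using that by simp_all
      then have "2 * (11 + u) mod 21 = 2 * u + 1" by (simp only: mod_add_self2 mod_less)
      then show "of_bool (w ! (2 * u + 1)) = ?f (11 + u)" by simp
    qed simp
    finally show ?thesis .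
  qed
  have l: "length ps = 10" "length qs = 10" by (simp_all add: ps_def qs_def)
  show tps: "trues ps = t" using tp[of 10] l H by simp
  show tqs: "trues qs = trues w - t" using tq[of 10] l H tot by simp
  have "map ((!) w) [0..<21] = interleave_rev (rev ps) (rev qs) [w ! 20]"
    by (simp add: ps_def qs_def upt_rec numeral_eq_Suc)
  then show "w = interleave_rev (rev ps) (rev qs) [False]"
    using H(2) unfolding list_21[OF w, symmetric] by (simp only: if_False simp_thms)
  define A where "A i \<longleftrightarrow> trues w - 2 * t + p (Suc i) \<le> q i" for i
  define B where "B j \<longleftrightarrow> q j \<le> p j" for j
  have cover: "(\<exists>i\<le>m. A i) \<or> (\<exists>j. m < j \<and> j \<le> 10 \<and> B j)" if m: "m \<le> 9" for m
  proof -
    \<comment> \<open>Index \<open>11 + m\<close> on the second circle is the odd slice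
      \<open>2 * m + 1\<close>; modulo 21, a light half circle containing it begins at
      \<open>m + u + 1\<close>.\<close>
    obtain u where u: "u \<le> 10" "half_circle w (11 + m + u + 11) \<le> t"
      using half_circle_le_first_value[OF w, of "11 + m"] assms(4)
      unfolding Alice_bounded_def by (meson order_trans)
    have "11 + m + u + 11 = (m + u + 1) + 21" by simp
    then have u2: "half_circle w (m + u + 1) \<le> t" using u(2) half_circle_add_21 by metis
    show ?thesis
    proof (cases "m + u + 1 \<le> 10")
      case True
      then have "B (m + u + 1)" using low[of "m + u + 1"] u2 H by (simp add: B_def)
      then show ?thesis using True by (intro disjI2 exI[of _ "m + u + 1"]) simp
    next
      case False
      define i where "i = m + u - 10"
      have i: "i \<le> m" "m + u + 1 = 11 + i" using False u(1) by (simp_all add: i_def)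
      then have "A i" using high[of i] u2 H tot t by (simp add: A_def)
      then show ?thesis using i by blast
    qed
  qed
  have tw: "2 * t < trues w" using t by simp
  have AB: "\<not> (A i \<and> B i)" for i
  proof -
    have "p i \<le> p (Suc i)" by (simp add: p_def)
    then show ?thesis using tw by (auto simp: A_def B_def)
  qed
  \<comment> \<open>All odd positions together hold \<open>trues w - t > t\<close> ones, so slice 19
    can be covered only through some \<open>A i\<close>.\<close>
  have "\<not> B 10" using H tot tw by (simp add: B_def)
  moreover have "j = 10" if "9 < j" "j \<le> 10" for j :: nat using that by simp
  ultimately have ex: "\<exists>i\<le>9. A i" using cover[of 9] by (metis order_refl)
  \<comment> \<open>By minimality no \<open>A\<close> covers the odd slice belonging to
    \<open>i - 1\<close>, so some \<open>B j\<close> with \<open>j \<ge> i\<close> does, and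
    \<open>AB\<close> excludes \<open>j = i\<close>.\<close>
  define i where "i = (LEAST i. A i)"
  have i: "A i" "i \<le> 9" "\<And>i'. i' < i \<Longrightarrow> \<not> A i'"
    using ex LeastI_ex[of A] Least_le[of A] not_less_Least[of _ A] unfolding i_def
    by (blast intro: order_trans)+
  have "\<not> A 0" using tw by (simp add: A_def q_def)
  then have "i \<noteq> 0" using i(1) by metis
  then have "\<not> (\<exists>i'\<le>i - 1. A i')" using i(3) by auto
  moreover have "i - 1 \<le> 9" using i(2) by simp
  ultimately obtain j where "i - 1 < j" "j \<le> 10" "B j" using cover[of "i - 1"] by blast
  then have j: "i \<le> j" "j \<le> 10" "B j" by simp_all
  then have "i < j" using AB[of i] i(1) by (metis le_neq_implies_less)
  show "rises (trues w - 2 * t) (rev ps) (rev qs)"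
    using i j \<open>i < j\<close> by (intro rises_rev[OF l(1,2) \<open>i < j\<close> j(2)]) (simp_all add: tp tq A_def B_def)
qed

section \<open>Classification\<close>

definition bob_pattern :: "bool list" where
  "bob_pattern = [False, False, True, False, True, False, False, True, False, True, False, True,
     False, False, True, False, True, False, True, False, True]"

text \<open>The ways to rotate the pattern and its mirror image such that slice 0 begins a light half circle
  and slice 19 a heavy one.\<close>

definition exceptional :: "bool list list" where
  "exceptional = [rotate 6 bob_pattern, rotate 9 bob_pattern, rotate 20 bob_pattern,
     rotate 4 (rev bob_pattern), rotate 15 (rev bob_pattern), rotate 18 (rev bob_pattern)]"

text \<open>First moves of Alice, ordered so that almost every candidate is refuted by an early one.\<close>

definition starts :: "nat list" where
  "starts = [19, 1, 16, 3, 14, 12, 5, 10, 7, 8, 15, 9, 4, 6, 13, 11]"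

lemma search_7: "search starts exceptional 3 1 3 3"
  unfolding search_def starts_def exceptional_def bob_pattern_def eval_nat_numeral BitM.simps One_nat_def
  by code_simp

text \<open>Nine ones is the case of the exceptional patterns. It is split by slice 18, with
  \<open>Suc 3\<close> written so that \<open>nat.case\<close> applies.\<close>

lemma search_9_even_end_False: "search_rise starts exceptional 4 1 9 (Suc 3) 4 [False, True, False]"
  unfolding search_def starts_def exceptional_def bob_pattern_def eval_nat_numeral BitM.simps One_nat_def
  by code_simp

lemma search_9_even_end_True: "search_rise starts exceptional 4 1 9 3 4 [True, True, False]"
  unfolding search_def starts_def exceptional_def bob_pattern_def eval_nat_numeral BitM.simps One_nat_def
  by code_simp

lemma search_9: "search starts exceptional 4 1 (Suc 3) 4"
  unfolding search_def nat.case using search_9_even_end_False search_9_even_end_True by (rule conjI)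

lemma search_rest:
  "search starts exceptional 0 1 0 0"
  "search starts exceptional 0 2 0 1"
  "search starts exceptional 1 1 1 1"
  "search starts exceptional 1 2 1 2"
  "search starts exceptional 2 1 2 2"
  "search starts exceptional 2 2 2 3"
  "search starts exceptional 3 2 3 4"
  "search starts exceptional 4 2 4 5"
  "search starts exceptional 4 3 4 6"
  "search starts exceptional 5 2 5 6"
  "search starts exceptional 5 3 5 7"
  "search starts exceptional 6 2 6 7"
  "search starts exceptional 6 3 6 8"
  "search starts exceptional 7 2 7 8"
  "search starts exceptional 7 3 7 9"
  "search starts exceptional 8 2 8 9"
  unfolding search_def starts_def exceptional_def bob_pattern_def eval_nat_numeral BitM.simps One_nat_def
  by code_simp+

lemma search_all:
  assumes "1 \<le> k" "k \<le> 18"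
  shows "search starts exceptional (4 * k div 9) (k - 2 * (4 * k div 9)) (4 * k div 9) (k - 4 * k div 9 - 1)"
proof -
  have "k \<in> set [1..<19]" using assms by simp
  then have "k = 1 \<or> k = 2 \<or> k = 3 \<or> k = 4 \<or> k = 5 \<or> k = 6 \<or> k = 7 \<or> k = 8 \<or> k = 9 \<or>
      k = 10 \<or> k = 11 \<or> k = 12 \<or> k = 13 \<or> k = 14 \<or> k = 15 \<or> k = 16 \<or> k = 17 \<or> k = 18"
    by (auto simp add: upt_rec numeral_eq_Suc)
  then show ?thesis
    by (elim disjE) (simp_all add: search_rest[simplified] search_7[simplified] search_9[simplified])
qed

lemma trues_rotate: "trues (rotate m w) = trues w"
proof -
  have "trues (rotate m w) = trues (drop (m mod length w) w) + trues (take (m mod length w) w)"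
    by (simp add: rotate_drop_take)
  then show ?thesis
    by (metis append_take_drop_id count_list_append add.commute)
qed

text \<open>The circle is rotated to the threshold between a heavy and a light half circle, where
  the search applies, and rotated back.\<close>

lemma Alice_bounded_imp_bob_pattern:
  assumes w: "length w = 21" "0 < trues w" and b: "Alice_bounded (4 * trues w div 9) w"
  shows "\<exists>m. w = rotate m bob_pattern \<or> w = rotate m (rev bob_pattern)"
proof -
  define k t where "k = trues w" and "t = 4 * k div 9"
  have t: "9 * t \<le> 4 * k" by (simp add: t_def)
  obtain a where a: "half_circle w a > t" "half_circle w (a + 1) \<le> t"
    using half_circle_threshold[OF w(1) _ w(2), of t] t b unfolding k_def t_def by blast
  define v where "v = rotate (2 * (a + 1)) w"
  define ps where "ps = map (\<lambda>u. v ! (2 * u)) [0..<10]"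
  define qs where "qs = map (\<lambda>u. v ! (2 * u + 1)) [0..<9]"
  have v: "length v = 21" "trues v = k" "Alice_bounded t v"
    using w(1) b unfolding v_def k_def t_def
    by (simp_all only: length_rotate trues_rotate Alice_bounded_rotate)
  have "half_circle v 0 \<le> t" "t < half_circle v 20"
  proof -
    show "half_circle v 0 \<le> t" unfolding v_def half_circle_rotate[OF w(1)] using a(2) by simp
    have "20 + (a + 1) = a + 21" by simp
    then show "t < half_circle v 20"
      unfolding v_def half_circle_rotate[OF w(1)] using a(1) by (simp only: half_circle_add_21)
  qed
  note P = half_circle_path[OF v(1) this v(3), unfolded v(2), OF t]
  have k: "0 < k" using w(2) by (simp add: k_def)
  have qs: "map (\<lambda>u. v ! (2 * u + 1)) [0..<10] = qs @ [True]"
  proof -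
    have "[0..<10] = [0..<9] @ [9]" by (simp add: upt_rec)
    then show ?thesis using P(2)[OF k] by (simp add: qs_def)
  qed
  note P = P[OF k, folded ps_def, unfolded qs]
  have tq: "trues (rev qs) = k - t - 1" and tp: "trues (rev ps) = t"
    using P(3,4) by (simp_all add: count_list_rev)
  have l: "length (rev ps) = 10" "length (rev qs) = 9" by (simp_all add: ps_def qs_def)
  \<comment> \<open>There are ten odd positions; this bound gives \<open>k \<le> 18\<close>.\<close>
  have "k - t \<le> 10" using P(4) count_le_length[of "qs @ [True]" True] l by simp
  then have "search starts exceptional t (k - 2 * t) (trues (rev ps)) (trues (rev qs))"
    using search_all[of k] k t unfolding tq tp t_def by simp
  moreover have "trues (rev ps) \<le> trues (rev qs)" using k t unfolding tq tp by simp
  ultimately have "settled starts exceptional t v"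
    using search[OF _ l] P(1,5) by (simp add: tp)
  then have "v \<in> set exceptional"
    using not_wins_from_any[OF v(3)] v(1) by (simp add: settled_def)
  then obtain c where c: "v = rotate c bob_pattern \<or> v = rotate c (rev bob_pattern)"
    unfolding exceptional_def by auto
  \<comment> \<open>Twenty further copies of the rotation complete a multiple of 21 and so undo
    it.\<close>
  have "rotate (20 * (2 * (a + 1))) v = rotate (21 * (2 * (a + 1))) w"
    unfolding v_def rotate_rotate by (simp add: algebra_simps)
  also have "\<dots> = w" using w(1) by (subst rotate_conv_mod) simp
  finally have "w = rotate (20 * (2 * (a + 1))) v" ..
  then show ?thesis using c by (metis rotate_rotate)
qed

lemma map_rotate_of_bool:
  "map (\<lambda>b. c * of_bool b) (rotate m w) = map ((*) c) (rotate m (map of_bool w))" for c :: real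
  by (simp add: rotate_map)

lemma bob_pattern_simps:
  "length bob_pattern = 21" "trues bob_pattern = 9"
  by (simp_all add: bob_pattern_def)

lemma bob_pattern_bounds:
  "Alice_bounded 4 bob_pattern" "Alice_bounded 4 (rev bob_pattern)"
  "3 < first_value (rotate 2 bob_pattern)" "3 < first_value (rotate 2 (rev bob_pattern))"
proof -
  let ?rs = "[0,1,2,3,4,5,6,7,8,9,10,11,12,13,14,15,16,17,18,19,20] :: nat list"
  have *: "\<not> wins_from_any 4 bob_pattern ?rs" "\<not> wins_from_any 4 (rev bob_pattern) ?rs"
    "wins_from 3 bob_pattern 2" "wins_from 3 (rev bob_pattern) 2"
    unfolding bob_pattern_def eval_nat_numeral BitM.simps One_nat_def by code_simp+
  have rs: "{..<21} \<subseteq> set ?rs"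
    by (auto simp: lessThan_nat_numeral lessThan_Suc)
  show "Alice_bounded 4 bob_pattern"
    by (rule Alice_boundedI[OF *(1)]) (simp_all only: length_rev bob_pattern_simps(1) rs, simp)
  show "Alice_bounded 4 (rev bob_pattern)"
    by (rule Alice_boundedI[OF *(2)]) (simp_all only: length_rev bob_pattern_simps(1) rs, simp)
  show "3 < first_value (rotate 2 bob_pattern)" "3 < first_value (rotate 2 (rev bob_pattern))"
    using *(3,4) wins_from_iff[of 2] by (simp_all add: bob_pattern_simps(1))
qed

section \<open>Cuttings with at most two sizes\<close>

lemma two_sizes_cases:
  fixes P :: "real list"
  assumes "cutting P" "card (set P) \<le> 2" "0 < sum_list P"
  obtains x c w where "0 \<le> x" "0 < c" "P = map (\<lambda>b. x + c * of_bool b) w" "0 < trues w"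
proof -
  define x y where "x = Min (set P)" and "y = Max (set P)"
  have ne: "set P \<noteq> {}" using assms(1) by (simp add: cutting_def)
  then have xy: "x \<in> set P" "y \<in> set P" "x \<le> y" "0 \<le> x"
    using assms(1) by (auto simp: x_def y_def cutting_def)
  show ?thesis
  proof (cases "x = y")
    case True
    then have "z = y" if "z \<in> set P" for z
      using that by (metis List.finite_set Max_ge Min_le antisym x_def y_def)
    then have P: "P = replicate (length P) y" by (metis replicate_length_same)
    then have "0 < y" using assms(3) xy True by (metis less_eq_real_def sum_list_replicate mult_zero_right less_irrefl)
    \<comment> \<open>A single size is treated as a pattern of ones only, over
      \<open>x = 0\<close>.\<close>
    moreover have "P = map (\<lambda>b. 0 + y * of_bool b) (replicate (length P) True)" using P by simp
    moreover have "0 < trues (replicate (length P) True)"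
      using ne by (cases P) auto
    ultimately show ?thesis using that by blast
  next
    case False
    then have "card {x, y} = 2" by simp
    then have "set P = {x, y}" using xy assms(2) by (metis List.finite_set bot.extremum card_seteq insert_subset)
    then have "map (\<lambda>z. x + (y - x) * of_bool (z = y)) P = map (\<lambda>z. z) P"
      using False by (intro map_cong) auto
    then have "P = map (\<lambda>b. x + (y - x) * of_bool b) (map (\<lambda>z. z = y) P)"
      unfolding map_map comp_def by simp
    moreover have "0 < trues (map (\<lambda>z. z = y) P)"
      using xy(2) by (auto simp: count_list_0_iff zero_less_iff_neq_zero)
    ultimately show ?thesis using that[of x "y - x" "map (\<lambda>z. z = y) P"] xy False by linarith
  qed
qed

text \<open>Positivity of the sum excludes the zero cutting, which gives Bob his gain trivially but
  is no positive multiple of the pattern.\<close>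

theorem theorem5:
  fixes P :: "real list"
  shows "(cutting P \<and> length P = 21 \<and> card (set P) \<le> 2 \<and> 0 < sum_list P \<and>
          (\<exists>\<sigma>. has_gain P Bob \<sigma> (5 * sum_list P / 9)))
     \<longleftrightarrow> same_cutting P [0,0,1,0,1,0,0,1,0,1,0,1,0,0,1,0,1,0,1,0,1]"
    (is "?L \<longleftrightarrow> same_cutting P ?Q")
proof
  have Q: "?Q = map of_bool bob_pattern" "rev ?Q = map of_bool (rev bob_pattern)"
    by (simp_all add: bob_pattern_def)
  {
    assume L: ?L
    then obtain x c w where x: "0 \<le> x" and c: "0 < c" and P: "P = map (\<lambda>b. x + c * of_bool b) w"
      and w: "0 < trues w" using two_sizes_cases by blast
    have len: "length w = 21" using L P by simp
    have gain: "11 * x + c * real (first_value (rotate r w)) \<le> 4 / 9 * (21 * x + c * real (trues w))" for r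
    proof -
      have "r mod 21 < 21" by simp
      then have "11 * x + c * real (first_value (rotate (r mod 21) w)) \<le> 4 / 9 * (21 * x + c * real (trues w))"
        using L c two_sizes_Bob_gain_iff[of c w x] len P by auto
      then show ?thesis using rotate_conv_mod[of r w] len by simp
    qed
    have "first_value (rotate r w) \<le> 4 * trues w div 9" for r
    proof -
      \<comment> \<open>Since \<open>11 > 4 / 9 * 21\<close>, a nonnegative \<open>x\<close> may be
        dropped from the inequality.\<close>
      have "c * (9 * real (first_value (rotate r w))) \<le> c * (4 * real (trues w))"
        using gain[of r] x by (simp add: field_simps)
      then have "9 * first_value (rotate r w) \<le> 4 * trues w" using c by simp
      then show ?thesis by simp
    qed
    then have "\<exists>m. w = rotate m bob_pattern \<or> w = rotate m (rev bob_pattern)"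
      using Alice_bounded_imp_bob_pattern[OF len w] by (simp add: Alice_bounded_def)
    then obtain m where m: "w = rotate m bob_pattern \<or> w = rotate m (rev bob_pattern)" ..
    then have nine: "trues w = 9" by (auto simp: trues_rotate count_list_rev bob_pattern_simps)
    have "rotate (2 + 20 * m) (rotate m v) = rotate 2 v" if "length v = 21" for v :: "bool list"
    proof -
      have "2 + 20 * m + m = 2 + 21 * m" by simp
      then show ?thesis using that rotate_conv_mod[of "2 + 21 * m" v] rotate_conv_mod[of 2 v]
        by (simp only: rotate_rotate mod_mult_self2)
    qed
    then have "3 < first_value (rotate (2 + 20 * m) w)"
      using m bob_pattern_bounds(3,4) bob_pattern_simps(1) by auto
    then have "c * 4 \<le> c * real (first_value (rotate (2 + 20 * m) w))" using c by simp
    \<comment> \<open>Alice gets at least 4 of the nine ones from this start, so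
      \<open>4 * c\<close> already exhausts the bound at \<open>x = 0\<close>, and a positive
      \<open>x\<close> would exceed it.\<close>
    then have "x = 0" using gain[of "2 + 20 * m"] x nine by (simp add: field_simps)
    then have "P = map (\<lambda>b. c * of_bool b) w" using P by simp
    then have "P = map ((*) c) (rotate m ?Q) \<or> P = map ((*) c) (rotate m (rev ?Q))"
      using m unfolding Q(2) unfolding Q(1) by (auto simp only: map_rotate_of_bool)
    then show "same_cutting P ?Q" using c unfolding same_cutting_def by blast
  }
  {
    assume "same_cutting P ?Q"
    then obtain c m v where c: "c > 0" and P: "P = map ((*) c) (rotate m (map of_bool v))"
      and v: "v = bob_pattern \<or> v = rev bob_pattern"
      unfolding same_cutting_def Q(2) unfolding Q(1) by blast
    define w where "w = rotate m v"
    have P0: "P = map (\<lambda>b. c * of_bool b) w" unfolding P w_def map_rotate_of_bool ..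
    have P': "P = map (\<lambda>b. 0 + c * of_bool b) w" using P0 by simp
    have w: "length w = 21" "trues w = 9" "Alice_bounded 4 w"
      using v bob_pattern_bounds(1,2) Alice_bounded_rotate
      by (auto simp: w_def trues_rotate count_list_rev bob_pattern_simps)
    have "set P \<subseteq> {0, c}" unfolding P0 by auto
    then have "card (set P) \<le> card {0, c}" by (intro card_mono) auto
    then have "card (set P) \<le> 2" using c by simp
    moreover have "cutting P" "length P = 21" unfolding P0 cutting_def using w(1) c by auto
    moreover have "0 < sum_list P" unfolding P' sum_list_two_sizes using c w by simp
    moreover have "\<exists>\<sigma>. has_gain P Bob \<sigma> (5 * sum_list P / 9)"
      unfolding P' two_sizes_Bob_gain_iff[OF less_imp_le[OF c] w(1)]
      using w(2,3) c by (auto simp: Alice_bounded_def)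
    ultimately show ?L by blast
  }
qed

end
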